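(* Consider the stochastic approximation recursion started at $(\theta_0,X_0)=(\theta,x)\in\Theta\times\mathsf{X}$ and defined for $i\ge0$ by $$X_{i+1}\mid\mathcal{F}_i\sim P_{\theta_i}(X_i,\cdot),\qquad\theta_{i+1}=\theta_i+\gamma_{i+1}H(\theta_i,X_{i+1}).$$ Assume (A4) and (A5) described in the context, that $\limsup_{i\to\infty}\gamma_i=0$, and let $M\in(M_0,M_1]$. Assume that there exists $\mathsf{C}\subset\mathsf{X}$ such that: (1) for any $\epsilon>0$, $$\limsup_{l\to\infty}\ \sup_{(\theta,x)\in\mathcal{W}_{M_0}\times\mathsf{C}}\bar{\mathbb{P}}_{\theta,x}^{\boldsymbol{\gamma}^{\leftarrow l}}\left(\sup_{k\ge1}\mathbb{I}\{\sigma(\mathcal{W}_M)\ge k\}\left|\sum_{j=1}^k\gamma_{j+l}\varsigma_j\right|>\epsilon\right)<1;$$ (2) for any $(\theta,x)\in\Theta\times\mathsf{X}$, $$\mathbb{P}_{\theta,x}\left(\bigcap_{k=1}^\infty\bigcup_{i=k}^\infty\{(\theta_i,X_i)\in\mathcal{W}_{M_0}\times\mathsf{C}\}\right)=1.$$ Then, for any $(\theta,x)\in\Theta\times\mathsf{X}$, $$\mathbb{P}_{\theta,x}\left(\bigcup_{k=1}^\infty\bigcap_{i=k}^\infty\{\theta_i\in\mathcal{W}_M\}\right)=1,$$ that is, $\{\theta_i\}$ eventually remains in $\mathcal{W}_M$, $\mathbb{P}_{\theta,x}$-a.s.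
   Context: Setting: $\mathsf{X}\subset\mathbb{R}^{n_x}$, $\Theta\subset\mathbb{R}^{n_\theta}$; $\{P_\theta,\theta\in\Theta\}$ is a family of Markov transition probabilities on $(\mathsf{X},\mathcal{B}(\mathsf{X}))$, $\{\pi_\theta,\theta\in\Theta\}$ a family of probability distributions on $(\mathsf{X},\mathcal{B}(\mathsf{X}))$, $H:\Theta\times\mathsf{X}\to\mathbb{R}^{n_\theta}$, $h(\theta):=\int_{\mathsf{X}}H(\theta,x)\pi_\theta(\mathrm{d}x)$, $\mathcal{F}_i:=\sigma(\theta_0,X_0,X_1,\ldots,X_i)$, and $\mathbb{P}_{\theta,x}$ is the law of the recursion started at $(\theta,x)$. $\langle\cdot,\cdot\rangle$ and $|\cdot|$ are the Euclidean inner product and norm. For the function $w$ below, $\mathcal{W}_M:=\{\theta\in\Theta:w(\theta)\le M\}$. (A4): (1) there exists $\gamma_+>0$ such that $\{\gamma_i\}\subset[0,\gamma_+]$ and for all $(\theta,x)\in\Theta\times\mathsf{X}$ and $\gamma\in[0,\gamma_+]$, $\theta+\gamma H(\theta,x)\in\Theta$; (2) for any $\theta\in\Theta$, $\int_{\mathsf{X}}|H(\theta,x)|\pi_\theta(\mathrm{d}x)<\infty$; (3) for any $\theta\in\Theta$, $\pi_\theta P_\theta=\pi_\theta$. (A5): $\Theta$ is an open subset of $\mathbb{R}^{n_\theta}$, $h:\Theta\to\mathbb{R}^{n_\theta}$ is continuous and there exists a continuously differentiable function $w:\Theta\to[0,\infty)$ such that: (1) there exists $M_0>0$ such that $\mathcal{L}:=\{\theta\in\Theta:\langle\nabla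 w(\theta),h(\theta)\rangle=0\}\subset\{\theta\in\Theta:w(\theta)<M_0\}$; (2) there exists $M_1\in(M_0,\infty]$ such that $\mathcal{W}_{M_1}$ is a compact set; (3) for any $\theta\in\Theta\setminus\mathcal{L}$, $\langle\nabla w(\theta),h(\theta)\rangle<0$. Shifted process: for $l\ge0$, $\boldsymbol{\gamma}^{\leftarrow l}:=\{\gamma_{i+l},i\ge0\}$, and $\bar{\mathbb{P}}_{\theta,x}^{\boldsymbol{\gamma}^{\leftarrow l}}$ is the law of the process $\{\vartheta_i,\mathfrak{X}_i\}$ with $\vartheta_0=\theta$, $\mathfrak{X}_0=x$ and, for $i\ge0$, $\mathfrak{X}_{i+1}\mid(\vartheta_0,\mathfrak{X}_0,\ldots,\mathfrak{X}_i)\sim P_{\vartheta_i}(\mathfrak{X}_i,\cdot)$, $\vartheta_{i+1}=\vartheta_i+\gamma_{i+1+l}H(\vartheta_i,\mathfrak{X}_{i+1})$. Moreover $\sigma(\mathcal{W}_M):=\inf\{k\ge1:\vartheta_k\notin\mathcal{W}_M\}$ (with $\inf\emptyset=+\infty$) and $\varsigma_j:=H(\vartheta_{j-1},\mathfrak{X}_j)-h(\vartheta_{j-1})$ for $j\ge1$. *)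

theory Defs
  imports "HOL-Probability.Probability"
begin

definition gradient :: "('a::real_inner \<Rightarrow> real) \<Rightarrow> 'a \<Rightarrow> 'a" where
  "gradient w \<theta> = (THE D. GDERIV w \<theta> :> D)"

(* M is an extended real because the level of a sublevel set may be infinite. *)
definition sublevel :: "'a set \<Rightarrow> ('a \<Rightarrow> real) \<Rightarrow> ereal \<Rightarrow> 'a set" where
  "sublevel \<Theta> w M = {\<theta> \<in> \<Theta>. ereal (w \<theta>) \<le> M}"

definition mean_field ::
  "('a \<Rightarrow> 'b measure) \<Rightarrow> ('a \<Rightarrow> 'b \<Rightarrow> 'a::euclidean_space) \<Rightarrow> 'a \<Rightarrow> 'a" where
  "mean_field \<pi> H \<theta> = (\<integral>x. H \<theta> x \<partial>\<pi> \<theta>)"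

definition sa_space ::
  "'a::topological_space set \<Rightarrow> 'b::topological_space set \<Rightarrow> ('a \<times> 'b) measure" where
  "sa_space \<Theta> X = restrict_space borel \<Theta> \<Otimes>\<^sub>M restrict_space borel X"

(* The conditional law of the pair at time i + 1 given the pair at time i. *)
definition sa_kernel ::
  "'a::euclidean_space set \<Rightarrow> 'b::euclidean_space set \<Rightarrow> ('a \<Rightarrow> 'b \<Rightarrow> 'b measure) \<Rightarrow>
   ('a \<Rightarrow> 'b \<Rightarrow> 'a) \<Rightarrow> (nat \<Rightarrow> real) \<Rightarrow> nat \<Rightarrow> 'a \<times> 'b \<Rightarrow> ('a \<times> 'b) measure" where
  "sa_kernel \<Theta> X P H \<gamma> i = (\<lambda>(\<theta>, x).
     distr (P \<theta> x) (sa_space \<Theta> X) (\<lambda>x'. (\<theta> + \<gamma> (Suc i) *\<^sub>R H \<theta> x', x')))"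

(* The Ionescu-Tulcea kernels take the whole past \<omega> 0, ..., \<omega> (n - 1);
   the kernel for n = 0 is the initial distribution. *)
definition sa_step ::
  "'a::euclidean_space set \<Rightarrow> 'b::euclidean_space set \<Rightarrow> ('a \<Rightarrow> 'b \<Rightarrow> 'b measure) \<Rightarrow>
   ('a \<Rightarrow> 'b \<Rightarrow> 'a) \<Rightarrow> (nat \<Rightarrow> real) \<Rightarrow> 'a \<Rightarrow> 'b \<Rightarrow>
   nat \<Rightarrow> (nat \<Rightarrow> 'a \<times> 'b) \<Rightarrow> ('a \<times> 'b) measure" where
  "sa_step \<Theta> X P H \<gamma> \<theta> x n \<omega> =
     (case n of 0 \<Rightarrow> return (sa_space \<Theta> X) (\<theta>, x) | Suc i \<Rightarrow> sa_kernel \<Theta> X P H \<gamma> i (\<omega> i))"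

(* The law, on the path space of the pairs (theta_i, X_i), of the recursion started at (\<theta>, x):
   the projective limit of the finite-dimensional distributions built from the kernels above.
   The law of the process shifted by l is the one with step sizes \<lambda>i. \<gamma> (i + l). *)
definition sa_law ::
  "'a::euclidean_space set \<Rightarrow> 'b::euclidean_space set \<Rightarrow> ('a \<Rightarrow> 'b \<Rightarrow> 'b measure) \<Rightarrow>
   ('a \<Rightarrow> 'b \<Rightarrow> 'a) \<Rightarrow> (nat \<Rightarrow> real) \<Rightarrow> 'a \<Rightarrow> 'b \<Rightarrow> (nat \<Rightarrow> 'a \<times> 'b) measure" where
  "sa_law \<Theta> X P H \<gamma> \<theta> x = projective_family.lim UNIV
     (Ionescu_Tulcea.CI (sa_step \<Theta> X P H \<gamma> \<theta> x) (\<lambda>_. sa_space \<Theta> X)) (\<lambda>_. sa_space \<Theta> X)"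

(* The infimum of the empty set is \<infinity> in enat. *)
definition exit_time :: "'a set \<Rightarrow> (nat \<Rightarrow> 'a \<times> 'b) \<Rightarrow> enat" where
  "exit_time W \<omega> = Inf {enat k | k. 1 \<le> k \<and> fst (\<omega> k) \<notin> W}"

definition noise ::
  "('a \<Rightarrow> 'b \<Rightarrow> 'a::euclidean_space) \<Rightarrow> ('a \<Rightarrow> 'a) \<Rightarrow> (nat \<Rightarrow> 'a \<times> 'b) \<Rightarrow> nat \<Rightarrow> 'a" where
  "noise H h \<omega> j = H (fst (\<omega> (j - 1))) (snd (\<omega> j)) - h (fst (\<omega> (j - 1)))"

lemma measurable_sa_kernel:
  assumes P: "(\<lambda>(\<theta>, x). P \<theta> x) \<in> sa_space \<Theta> X \<rightarrow>\<^sub>M prob_algebra (restrict_space borel X)"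
    and H: "(\<lambda>(\<theta>, x). H \<theta> x) \<in> borel_measurable (sa_space \<Theta> X)"
    and \<Theta>: "\<And>\<theta> x. \<theta> \<in> \<Theta> \<Longrightarrow> x \<in> X \<Longrightarrow> \<theta> + \<gamma> (Suc i) *\<^sub>R H \<theta> x \<in> \<Theta>"
  shows "sa_kernel \<Theta> X P H \<gamma> i \<in> sa_space \<Theta> X \<rightarrow>\<^sub>M prob_algebra (sa_space \<Theta> X)"
proof -
  let ?T = "restrict_space borel \<Theta> :: 'a measure" and ?X = "restrict_space borel X :: 'b measure"
  let ?S = "sa_space \<Theta> X"
  let ?g = "\<lambda>p. fst (fst p) + \<gamma> (Suc i) *\<^sub>R H (fst (fst p)) (snd p)"
  have sp: "space (?S \<Otimes>\<^sub>M ?X) = (\<Theta> \<times> X) \<times> X"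
    by (simp add: sa_space_def space_pair_measure space_restrict_space)
  have p1: "fst \<in> ?S \<rightarrow>\<^sub>M ?T"
    by (simp add: sa_space_def)
  have q1: "(\<lambda>p. fst (fst p)) \<in> ?S \<Otimes>\<^sub>M ?X \<rightarrow>\<^sub>M ?T"
    by (rule measurable_compose[OF measurable_fst p1])
  have incl: "(\<lambda>\<theta>. \<theta>) \<in> ?T \<rightarrow>\<^sub>M borel"
    by (rule measurable_restrict_space1) simp
  have f: "(\<lambda>p. fst (fst p)) \<in> borel_measurable (?S \<Otimes>\<^sub>M ?X)"
    by (rule measurable_compose[OF q1 incl])
  have "(\<lambda>p. (fst (fst p), snd p)) \<in> ?S \<Otimes>\<^sub>M ?X \<rightarrow>\<^sub>M ?T \<Otimes>\<^sub>M ?X"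
    by (rule measurable_Pair[OF q1 measurable_snd])
  from measurable_compose[OF this[folded sa_space_def] H]
  have "(\<lambda>p. H (fst (fst p)) (snd p)) \<in> borel_measurable (?S \<Otimes>\<^sub>M ?X)"
    by simp
  then have "?g \<in> borel_measurable (?S \<Otimes>\<^sub>M ?X)"
    using f by (intro borel_measurable_add borel_measurable_scaleR borel_measurable_const)
  then have "?g \<in> ?S \<Otimes>\<^sub>M ?X \<rightarrow>\<^sub>M ?T"
    by (rule measurable_restrict_space2[rotated]) (auto simp: sp intro!: \<Theta>)
  then have "(\<lambda>p. (?g p, snd p)) \<in> ?S \<Otimes>\<^sub>M ?X \<rightarrow>\<^sub>M ?T \<Otimes>\<^sub>M ?X"
    by (rule measurable_Pair[OF _ measurable_snd])
  then have *: "(\<lambda>(z, x'). (fst z + \<gamma> (Suc i) *\<^sub>R H (fst z) x', x')) \<in> ?S \<Otimes>\<^sub>M ?X \<rightarrow>\<^sub>M ?S"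
    by (simp add: sa_space_def split_beta')
  show ?thesis
    using measurable_distr_prob_space2[OF P *]
    by (simp add: sa_kernel_def split_beta')
qed

lemma Ionescu_Tulcea_sa_step:
  assumes P: "(\<lambda>(\<theta>, x). P \<theta> x) \<in> sa_space \<Theta> X \<rightarrow>\<^sub>M prob_algebra (restrict_space borel X)"
    and H: "(\<lambda>(\<theta>, x). H \<theta> x) \<in> borel_measurable (sa_space \<Theta> X)"
    and \<Theta>: "\<And>i \<theta> x. \<theta> \<in> \<Theta> \<Longrightarrow> x \<in> X \<Longrightarrow> \<theta> + \<gamma> (Suc i) *\<^sub>R H \<theta> x \<in> \<Theta>"
    and "\<theta> \<in> \<Theta>" "x \<in> X"
  shows "Ionescu_Tulcea (sa_step \<Theta> X P H \<gamma> \<theta> x) (\<lambda>_. sa_space \<Theta> X)"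
proof -
  let ?S = "sa_space \<Theta> X"
  have z: "(\<theta>, x) \<in> space ?S"
    using assms(4,5) by (simp add: sa_space_def space_pair_measure space_restrict_space)
  have *: "sa_step \<Theta> X P H \<gamma> \<theta> x n \<in> PiM {0..<n} (\<lambda>_. ?S) \<rightarrow>\<^sub>M prob_algebra ?S" for n
  proof (cases n)
    case 0
    have "return ?S (\<theta>, x) \<in> space (prob_algebra ?S)"
      using z by (simp add: space_prob_algebra prob_space_return)
    with 0 show ?thesis
      by (simp add: sa_step_def[abs_def])
  next
    case (Suc i)
    have "(\<lambda>\<omega>. \<omega> i) \<in> PiM {0..<n} (\<lambda>_. ?S) \<rightarrow>\<^sub>M ?S"
      using Suc by (intro measurable_component_singleton) auto
    from measurable_compose[OF this measurable_sa_kernel[OF P H, of \<gamma> i]]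
    show ?thesis
      using Suc \<Theta> by (simp add: sa_step_def[abs_def])
  qed
  have "prob_space (sa_step \<Theta> X P H \<gamma> \<theta> x n \<omega>)" if "\<omega> \<in> space (PiM {0..<n} (\<lambda>_. ?S))" for n \<omega>
    using measurable_space[OF * that] by (simp add: space_prob_algebra)
  with measurable_prob_algebraD[OF *] show ?thesis
    by (intro Ionescu_Tulcea.intro)
qed

end

theory Submission
  imports Defs
begin

text \<open>
  If the accumulated noise of a trajectory started in \<open>W\<^bsub>M0\<^esub>\<close> stays small until the exit from
  \<open>W\<^bsub>M\<^esub>\<close> and the step sizes are small, then the Lyapunov function along the trajectory with the noise
  subtracted cannot cross the gap between \<open>M0\<close> and \<open>M\<close>, so the trajectory never exits. Hence there is
  \<open>q < 1\<close> such that, from every late visit to \<open>W\<^bsub>M0\<^esub> \<times> C\<close>, the exit probability is at most \<open>q\<close>.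
  Let \<open>s\<close> be the supremum, over late times and all states, of the probability that both \<open>W\<^bsub>M0\<^esub> \<times> C\<close>
  and the complement of \<open>W\<^bsub>M\<^esub>\<close> are visited infinitely often. This event is shift invariant and requires
  a visit to \<open>W\<^bsub>M0\<^esub> \<times> C\<close> followed by an exit, so the Markov property at these two hitting times gives
  \<open>s \<le> q * s\<close>, that is \<open>s = 0\<close>.
\<close>

section \<open>Path laws of inhomogeneous Markov chains\<close>

text \<open>The shape of \<open>sa_step\<close> with an arbitrary kernel sequence, so that the
  Markov theory is developed once and transferred by \<open>sa_law_shift_eq\<close>. Index 0 carries
  the point mass at the start, hence \<open>K i\<close> leads from time \<open>i\<close> to time
  \<open>i + 1\<close>.\<close>

definition chain_step :: "'s measure \<Rightarrow> (nat \<Rightarrow> 's \<Rightarrow> 's measure) \<Rightarrow> 's \<Rightarrow> nat \<Rightarrow> (nat \<Rightarrow> 's) \<Rightarrow> 's measure" where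
  "chain_step S K z n \<omega> = (case n of 0 \<Rightarrow> return S z | Suc i \<Rightarrow> K i (\<omega> i))"

definition chain_law :: "'s measure \<Rightarrow> (nat \<Rightarrow> 's \<Rightarrow> 's measure) \<Rightarrow> 's \<Rightarrow> (nat \<Rightarrow> 's) measure" where
  "chain_law S K z = projective_family.lim UNIV (Ionescu_Tulcea.CI (chain_step S K z) (\<lambda>_. S)) (\<lambda>_. S)"

locale markov_kernels =
  fixes S :: "'s measure" and K :: "nat \<Rightarrow> 's \<Rightarrow> 's measure"
  assumes K: "K i \<in> S \<rightarrow>\<^sub>M prob_algebra S"
begin

abbreviation paths :: "(nat \<Rightarrow> 's) measure" where
  "paths \<equiv> PiM UNIV (\<lambda>_. S)"

text \<open>\<open>l\<close> is the clock time at the start. The kernels are shifted rather than the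
  paths, so every path begins at coordinate 0 and one step of the chain leads from
  \<open>law l\<close> to \<open>law (Suc l)\<close>.\<close>

definition law :: "nat \<Rightarrow> 's \<Rightarrow> (nat \<Rightarrow> 's) measure" where
  "law l = chain_law S (\<lambda>i. K (i + l))"

text \<open>The expectation of \<open>f\<close> at coordinate \<open>n\<close> on the event that
  coordinate \<open>i\<close> lies in \<open>A i\<close> for all \<open>i < n\<close>, for the chain
  started in \<open>z\<close> at clock time \<open>l\<close>. The recursion peels coordinates off
  the front, as the Markov property does.\<close>

primrec cyl_weight :: "nat \<Rightarrow> (nat \<Rightarrow> 's set) \<Rightarrow> ('s \<Rightarrow> ennreal) \<Rightarrow> nat \<Rightarrow> 's \<Rightarrow> ennreal" where
  "cyl_weight 0 A f l z = f z"
| "cyl_weight (Suc n) A f l z =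
     indicator (A 0) z * (\<integral>\<^sup>+z'. cyl_weight n (\<lambda>i. A (Suc i)) f (Suc l) z' \<partial>K l z)"

lemma measurable_K_subprob: "K i \<in> S \<rightarrow>\<^sub>M subprob_algebra S"
  by (rule measurable_prob_algebraD[OF K])

lemma K_space: assumes "z \<in> space S"
  shows "prob_space (K i z)" "sets (K i z) = sets S" "space (K i z) = space S"
  using measurable_space[OF K assms, of i] sets_eq_imp_space_eq[of "K i z" S] by (auto simp: space_prob_algebra)

lemma borel_measurable_cyl_weight:
  assumes "\<And>i. A i \<in> sets S" "f \<in> borel_measurable S"
  shows "cyl_weight n A f l \<in> borel_measurable S"
  using assms
proof (induction n arbitrary: A l)
  case 0
  have "cyl_weight 0 A f l = f"
    by (rule ext) simp
  with 0 show ?case by simp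
next
  case (Suc n)
  have [measurable]: "cyl_weight n (\<lambda>i. A (Suc i)) f (Suc l) \<in> borel_measurable S" "A 0 \<in> sets S"
    using Suc by auto
  have [measurable]: "(\<lambda>z. \<integral>\<^sup>+z'. cyl_weight n (\<lambda>i. A (Suc i)) f (Suc l) z' \<partial>K l z) \<in> borel_measurable S"
    by (rule measurable_compose[OF measurable_K_subprob nn_integral_measurable_subprob_algebra]) measurable
  have "cyl_weight (Suc n) A f l = (\<lambda>z. indicator (A 0) z * (\<integral>\<^sup>+z'. cyl_weight n (\<lambda>i. A (Suc i)) f (Suc l) z' \<partial>K l z))"
    by (rule ext) simp
  then show ?case
    by simp
qed

text \<open>The Ionescu-Tulcea construction appends coordinates at the end, whereas
  \<open>cyl_weight\<close> recurses at the front. This reconciles the two by absorbing the last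
  integration into the test function.\<close>

lemma cyl_weight_Suc_last:
  assumes "z \<in> space S"
  shows "cyl_weight (Suc n) A f l z =
     cyl_weight n A (\<lambda>y. indicator (A n) y * (\<integral>\<^sup>+z'. f z' \<partial>K (n + l) y)) l z"
  using assms
proof (induction n arbitrary: A l z)
  case (Suc n)
  have "(\<integral>\<^sup>+z'. cyl_weight (Suc n) (\<lambda>i. A (Suc i)) f (Suc l) z' \<partial>K l z) =
      (\<integral>\<^sup>+z'. cyl_weight n (\<lambda>i. A (Suc i)) (\<lambda>y. indicator (A (Suc n)) y * (\<integral>\<^sup>+z'. f z' \<partial>K (n + Suc l) y)) (Suc l) z' \<partial>K l z)"
    by (rule nn_integral_cong, rule Suc.IH) (simp add: K_space[OF Suc.prems])
  then show ?case
    by (simp only: cyl_weight.simps(2)[of "Suc n" A f l z] cyl_weight.simps(2)[of n A _ l z] add_Suc add_Suc_right)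
qed simp

section \<open>Finite-dimensional distributions of the path laws\<close>

lemma Ionescu_Tulcea_law:
  assumes z: "z \<in> space S"
  shows "Ionescu_Tulcea (chain_step S (\<lambda>i. K (i + l)) z) (\<lambda>_. S)"
proof -
  have *: "chain_step S (\<lambda>i. K (i + l)) z n \<in> PiM {0..<n} (\<lambda>_. S) \<rightarrow>\<^sub>M prob_algebra S" for n
  proof (cases n)
    case 0
    have "return S z \<in> space (prob_algebra S)"
      using z by (simp add: space_prob_algebra prob_space_return)
    with 0 show ?thesis
      by (simp add: chain_step_def[abs_def])
  next
    case (Suc i)
    have "(\<lambda>\<omega>. \<omega> i) \<in> PiM {0..<n} (\<lambda>_. S) \<rightarrow>\<^sub>M S"
      using Suc by (intro measurable_component_singleton) auto
    from measurable_compose[OF this K, of "i + l"] show ?thesis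
      using Suc by (simp add: chain_step_def[abs_def])
  qed
  have "prob_space (chain_step S (\<lambda>i. K (i + l)) z n \<omega>)" if "\<omega> \<in> space (PiM {0..<n} (\<lambda>_. S))" for n \<omega>
    using measurable_space[OF * that] by (simp add: space_prob_algebra)
  with measurable_prob_algebraD[OF *] show ?thesis
    by (intro Ionescu_Tulcea.intro)
qed

text \<open>Induction on \<open>n\<close> for all \<open>f\<close> at once: integrating out the last
  coordinate turns \<open>f\<close> into another test function \<open>f'\<close> and removes one
  factor from the product.\<close>

lemma nn_integral_C_eq_cyl_weight:
  assumes z: "z \<in> space S" and A: "\<And>i. A i \<in> sets S" and f: "f \<in> borel_measurable S"
  shows "(\<integral>\<^sup>+\<omega>. (\<Prod>i<n. indicator (A i) (\<omega> i)) * f (\<omega> n)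
      \<partial>Ionescu_Tulcea.C (chain_step S (\<lambda>i. K (i + l)) z) (\<lambda>_. S) 0 (Suc n) (\<lambda>_. undefined))
    = cyl_weight n A f l z"
proof -
  interpret IT: Ionescu_Tulcea "chain_step S (\<lambda>i. K (i + l)) z" "\<lambda>_. S"
    by (rule Ionescu_Tulcea_law[OF z])
  let ?C = "\<lambda>n. IT.C 0 n (\<lambda>_. undefined)"
  \<comment> \<open>The constantly undefined function is the only path over the empty index set,
    from which the construction starts.\<close>
  have u: "(\<lambda>_. undefined) \<in> space (PiM {0..<0::nat} (\<lambda>_. S))"
    by (simp add: space_PiM)
  have step: "(\<integral>\<^sup>+\<omega>. g \<omega> \<partial>(?C (Suc n))) =
      (\<integral>\<^sup>+\<omega>. \<integral>\<^sup>+y. g (fun_upd \<omega> n y) \<partial>chain_step S (\<lambda>i. K (i + l)) z n \<omega> \<partial>(?C n))"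
    if g: "g \<in> borel_measurable (PiM {0..<Suc n} (\<lambda>_. S))" for g n
  proof -
    have "(\<integral>\<^sup>+\<omega>. g \<omega> \<partial>(?C (Suc n))) = (\<integral>\<^sup>+\<omega>. \<integral>\<^sup>+\<omega>'. g \<omega>' \<partial>IT.eP n \<omega> \<partial>(?C n))"
      using IT.measurable_eP[of n] IT.sets_C[OF u, of n] g
      by (simp, intro nn_integral_bind) (auto cong: measurable_cong_sets)
    also have "\<dots> = (\<integral>\<^sup>+\<omega>. \<integral>\<^sup>+y. g (fun_upd \<omega> n y) \<partial>chain_step S (\<lambda>i. K (i + l)) z n \<omega> \<partial>(?C n))"
      using IT.space_C[OF u, of n] g by (intro nn_integral_cong IT.nn_integral_eP) auto
    finally show ?thesis .
  qed
  show ?thesis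
    using f
  proof (induction n arbitrary: f)
    case 0
    have m: "(\<lambda>\<omega>. f (\<omega> 0)) \<in> borel_measurable (PiM {0..<Suc 0} (\<lambda>_. S))"
      using 0 by measurable
    have "(\<integral>\<^sup>+\<omega>. f (\<omega> 0) \<partial>(?C (Suc 0))) = (\<integral>\<^sup>+\<omega>. f z \<partial>(?C 0))"
      using z 0 by (subst step[OF m]) (simp add: chain_step_def nn_integral_return del: IT.C.simps)
    also have "\<dots> = f z"
      using prob_space.emeasure_space_1[OF IT.prob_space_C[OF u], of 0] by simp
    finally show ?case by (simp del: IT.C.simps)
  next
    case (Suc n)
    note [measurable] = A Suc.prems
    have g: "(\<lambda>\<omega>. (\<Prod>i<Suc n. indicator (A i) (\<omega> i)) * f (\<omega> (Suc n)))
        \<in> borel_measurable (PiM {0..<Suc (Suc n)} (\<lambda>_. S))"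
      by measurable
    define f' where "f' = (\<lambda>y. indicator (A n) y * (\<integral>\<^sup>+z'. f z' \<partial>K (n + l) y))"
    have [measurable]: "(\<lambda>z. \<integral>\<^sup>+z'. f z' \<partial>K (n+l) z) \<in> borel_measurable S"
      by (rule measurable_compose[OF measurable_K_subprob nn_integral_measurable_subprob_algebra]) measurable
    have f': "f' \<in> borel_measurable S"
      unfolding f'_def by measurable
    have "(\<integral>\<^sup>+\<omega>. (\<Prod>i<Suc n. indicator (A i) (\<omega> i)) * f (\<omega> (Suc n)) \<partial>(?C (Suc (Suc n))))
       = (\<integral>\<^sup>+\<omega>. \<integral>\<^sup>+y. (\<Prod>i<Suc n. indicator (A i) (\<omega> i)) * f y \<partial>K (n + l) (\<omega> n) \<partial>(?C (Suc n)))"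
      by (subst step[OF g], rule nn_integral_cong) (simp add: chain_step_def)
    also have "\<dots> = (\<integral>\<^sup>+\<omega>. (\<Prod>i<n. indicator (A i) (\<omega> i)) * f' (\<omega> n) \<partial>(?C (Suc n)))"
    proof (rule nn_integral_cong)
      fix \<omega> assume "\<omega> \<in> space (?C (Suc n))"
      then have "\<omega> n \<in> space S"
        using IT.space_C[OF u, of "Suc n"] by (auto simp: space_PiM)
      from K_space(2)[OF this] have "f \<in> borel_measurable (K (n + l) (\<omega> n))"
        using Suc.prems by (simp cong: measurable_cong_sets)
      then show "(\<integral>\<^sup>+y. (\<Prod>i<Suc n. indicator (A i) (\<omega> i)) * f y \<partial>K (n + l) (\<omega> n)) =
         (\<Prod>i<n. indicator (A i) (\<omega> i)) * f' (\<omega> n)"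
        by (simp add: nn_integral_cmult f'_def mult.assoc)
    qed
    also have "\<dots> = cyl_weight n A f' l z"
      by (rule Suc.IH[OF f'])
    also have "\<dots> = cyl_weight (Suc n) A f l z"
      unfolding f'_def using z by (rule cyl_weight_Suc_last[symmetric])
    finally show ?case .
  qed
qed

text \<open>The projective limit gives a cylinder the mass that the finite-horizon measure gives it,
  and that mass is a \<open>cyl_weight\<close> with test function 1.\<close>

lemma
  assumes z: "z \<in> space S"
  shows prob_space_law: "prob_space (law l z)"
    and sets_law: "sets (law l z) = sets paths"
    and space_law: "space (law l z) = space paths"
    and emeasure_law_cylinder: "(\<And>i. A i \<in> sets S) \<Longrightarrow>
      emeasure (law l z) {\<omega> \<in> space paths. \<forall>i<n. \<omega> i \<in> A i} = cyl_weight n A (\<lambda>_. 1) l z"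
proof -
  interpret IT: Ionescu_Tulcea "chain_step S (\<lambda>i. K (i + l)) z" "\<lambda>_. S"
    by (rule Ionescu_Tulcea_law[OF z])
  have law: "law l z = IT.PF.lim"
    by (simp add: law_def chain_law_def)
  show sets: "sets (law l z) = sets paths" and sp: "space (law l z) = space paths"
    by (simp_all add: law)
  have u: "(\<lambda>_. undefined) \<in> space (PiM {0..<0::nat} (\<lambda>_. S))"
    by (simp add: space_PiM)
  have cyl: "emeasure (law l z) {\<omega> \<in> space paths. \<forall>i<n. \<omega> i \<in> A i} = cyl_weight n A (\<lambda>_. 1) l z"
    if A: "\<And>i. A i \<in> sets S" for A n
  proof -
    have E: "PiE {0..<n} A \<in> sets (PiM {0..<n} (\<lambda>_. S))"
      using A by (intro sets_PiM_I_finite) auto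
    have eq: "{\<omega> \<in> space paths. \<forall>i<n. \<omega> i \<in> A i} = IT.PF.emb UNIV {0..<n} (PiE {0..<n} A)"
      using A[THEN sets.sets_into_space] by (auto simp: prod_emb_def space_PiM PiE_iff)
    have emb: "IT.PF.emb {0..<Suc n} {0..<n} (PiE {0..<n} A) \<in> sets (PiM {0..<Suc n} (\<lambda>_. S))"
      using E by (intro measurable_prod_emb) auto
    \<comment> \<open>The horizon is \<open>Suc n\<close> although only coordinates below
      \<open>n\<close> are constrained: \<open>nn_integral_C_eq_cyl_weight\<close> evaluates its
      test function, here 1, at coordinate \<open>n\<close>.\<close>
    have "emeasure (law l z) {\<omega> \<in> space paths. \<forall>i<n. \<omega> i \<in> A i} =
        emeasure (IT.C 0 (Suc n) (\<lambda>_. undefined)) (IT.PF.emb {0..<Suc n} {0..<n} (PiE {0..<n} A))"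
      unfolding eq law by (subst IT.lim[OF _ E]) (simp, rule IT.emeasure_CI[OF _ E], auto)
    also have "\<dots> = (\<integral>\<^sup>+\<omega>. indicator (IT.PF.emb {0..<Suc n} {0..<n} (PiE {0..<n} A)) \<omega>
        \<partial>IT.C 0 (Suc n) (\<lambda>_. undefined))"
      using emb IT.sets_C[OF u, of "Suc n"] by (subst nn_integral_indicator) auto
    also have "\<dots> = (\<integral>\<^sup>+\<omega>. (\<Prod>i<n. indicator (A i) (\<omega> i)) * 1 \<partial>IT.C 0 (Suc n) (\<lambda>_. undefined))"
    proof (rule nn_integral_cong)
      fix \<omega> assume "\<omega> \<in> space (IT.C 0 (Suc n) (\<lambda>_. undefined))"
      then have "\<omega> \<in> space (PiM {0..<Suc n} (\<lambda>_. S))"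
        using IT.space_C[OF u, of "Suc n"] by simp
      then have "indicator (IT.PF.emb {0..<Suc n} {0..<n} (PiE {0..<n} A)) \<omega> =
          indicator {\<omega>. \<forall>i<n. \<omega> i \<in> A i} \<omega>"
        by (auto simp: prod_emb_def space_PiM PiE_iff split: split_indicator)
      also have "\<dots> = (\<Prod>i<n. indicator (A i) (\<omega> i) :: ennreal)"
        by (auto split: split_indicator intro!: prod.neutral)
      finally show "indicator (IT.PF.emb {0..<Suc n} {0..<n} (PiE {0..<n} A)) \<omega> =
          (\<Prod>i<n. indicator (A i) (\<omega> i)) * (1 :: ennreal)" by simp
    qed
    also have "\<dots> = cyl_weight n A (\<lambda>_. 1) l z"
      by (rule nn_integral_C_eq_cyl_weight[OF z A]) simp_all
    finally show ?thesis .
  qed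
  then show "(\<And>i. A i \<in> sets S) \<Longrightarrow>
      emeasure (law l z) {\<omega> \<in> space paths. \<forall>i<n. \<omega> i \<in> A i} = cyl_weight n A (\<lambda>_. 1) l z" .
  show "prob_space (law l z)"
    \<comment> \<open>The cylinder that constrains no coordinate is the whole path space and has
      weight 1.\<close>
    using cyl[of "\<lambda>_. {}" 0] sp by (intro prob_spaceI) simp
qed

section \<open>Dependence on the initial state and decomposition at the first step\<close>

lemma emb_eq_cylinder:
  fixes n :: nat
  assumes "J \<subseteq> {..<n}"
  shows "prod_emb UNIV (\<lambda>_. S) J (PiE J E) =
    {\<omega> \<in> space paths. \<forall>i<n. \<omega> i \<in> (if i \<in> J then E i else space S)}"
  using assms by (auto simp: prod_emb_def space_PiM PiE_iff subset_iff)

text \<open>Cylinders are an intersection-stable generator, so it suffices to look at their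
  probabilities, which are measurable in the start by
  \<open>borel_measurable_cyl_weight\<close>.\<close>

lemma measurable_law: "law l \<in> S \<rightarrow>\<^sub>M prob_algebra paths"
proof (rule measurable_prob_algebra_generated[OF sets_PiM Int_stable_prod_algebra prod_algebra_sets_into_space])
  fix B :: "(nat \<Rightarrow> 's) set" assume "B \<in> prod_algebra UNIV (\<lambda>_. S)"
  then obtain J E where J: "finite J" and E: "\<And>i. i \<in> J \<Longrightarrow> E i \<in> sets S"
    and B: "B = prod_emb UNIV (\<lambda>_. S) J (PiE J E)"
    by (rule prod_algebraE) auto
  from J obtain n where n: "J \<subseteq> {..<n}"
    by (meson finite_nat_iff_bounded)
  let ?A = "\<lambda>i. if i \<in> J then E i else space S"
  have A: "?A i \<in> sets S" for i
    using E by auto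
  show "(\<lambda>z. emeasure (law l z) B) \<in> borel_measurable S"
  proof (subst measurable_cong)
    have eq: "prod_emb UNIV (\<lambda>_. S) J (PiE J E) = {\<omega> \<in> space paths. \<forall>i<n. \<omega> i \<in> ?A i}"
      by (rule emb_eq_cylinder[OF n])
    show "emeasure (law l z) B = cyl_weight n ?A (\<lambda>_. 1) l z" if "z \<in> space S" for z
      unfolding B eq by (rule emeasure_law_cylinder[OF that A])
  qed (auto intro!: borel_measurable_cyl_weight A)
qed (auto simp: prob_space_law sets_law)

lemma measurable_case_nat_path:
  assumes "z \<in> space S" shows "case_nat z \<in> paths \<rightarrow>\<^sub>M paths"
proof (rule measurable_PiM_single')
  show "(\<lambda>\<omega>. case_nat z \<omega> i) \<in> paths \<rightarrow>\<^sub>M S" for i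
    using assms by (cases i) auto
qed (use assms in \<open>auto simp: space_PiM PiE_iff split: nat.split\<close>)

text \<open>The Markov property at time 1: draw the next state, run the chain from it with the clock
  advanced by one, and prepend \<open>z\<close>. Both sides agree on cylinders by the front
  recursion of \<open>cyl_weight\<close>, and cylinders determine a finite measure.\<close>

lemma law_first_step:
  assumes z: "z \<in> space S"
  shows "law l z = K l z \<bind> (\<lambda>z'. distr (law (Suc l) z') paths (case_nat z))"
proof (rule measure_eqI_PiM_infinite)
  have Kz: "K l z \<in> space (prob_algebra S)"
    by (rule measurable_space[OF K z])
  have m: "(\<lambda>z'. distr (law (Suc l) z') paths (case_nat z)) \<in> S \<rightarrow>\<^sub>M prob_algebra paths"
    by (rule measurable_compose[OF measurable_law measurable_distr_prob_space[OF measurable_case_nat_path[OF z]]])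
  show "sets (law l z) = sets paths" by (rule sets_law[OF z])
  show "sets (K l z \<bind> (\<lambda>z'. distr (law (Suc l) z') paths (case_nat z))) = sets paths"
    using prob_space.not_empty[OF K_space(1)[OF z, of l]] by (intro sets_bind) auto
  interpret prob_space "law l z" by (rule prob_space_law[OF z])
  show "finite_measure (law l z)" by (rule finite_measure_axioms)
  fix E :: "nat \<Rightarrow> 's set" and J :: "nat set"
  assume J: "finite J" and E: "\<And>i. i \<in> J \<Longrightarrow> E i \<in> sets S"
  obtain n where n: "J \<subseteq> {..<n}"
    using J by (meson finite_nat_iff_bounded)
  define A where "A = (\<lambda>i. if i \<in> J then E i else space S)"
  have A: "A i \<in> sets S" for i
    using E by (auto simp: A_def)
  then have A': "A (Suc i) \<in> sets S" for i .
  have "prod_emb UNIV (\<lambda>_. S) J (PiE J E) = {\<omega> \<in> space paths. \<forall>i<n. \<omega> i \<in> A i}"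
    unfolding A_def by (rule emb_eq_cylinder[OF n])
  \<comment> \<open>Coordinate \<open>n\<close> lies outside \<open>J\<close> and is unconstrained;
    including it makes the length a successor, so that the recursion of \<open>cyl_weight\<close>
    unfolds once.\<close>
  also have "\<dots> = {\<omega> \<in> space paths. \<forall>i<Suc n. \<omega> i \<in> A i}"
    using n by (auto simp: A_def less_Suc_eq space_PiM PiE_iff)
  finally have eq: "prod_emb UNIV (\<lambda>_. S) J (PiE J E) = {\<omega> \<in> space paths. \<forall>i<Suc n. \<omega> i \<in> A i}" .
  have meas: "prod_emb UNIV (\<lambda>_. S) J (PiE J E) \<in> sets paths"
    using J E by (intro measurable_prod_emb sets_PiM_I_finite) auto
  have "emeasure (law l z) (prod_emb UNIV (\<lambda>_. S) J (PiE J E)) =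
     indicator (A 0) z * (\<integral>\<^sup>+z'. cyl_weight n (\<lambda>i. A (Suc i)) (\<lambda>_. 1) (Suc l) z' \<partial>K l z)"
    unfolding eq by (subst emeasure_law_cylinder[OF z A]) simp
  also have "\<dots> = (\<integral>\<^sup>+z'. indicator (A 0) z * cyl_weight n (\<lambda>i. A (Suc i)) (\<lambda>_. 1) (Suc l) z' \<partial>K l z)"
    using borel_measurable_cyl_weight[where f="\<lambda>_. 1" and n=n and l="Suc l", OF A'] K_space[OF z]
    by (intro nn_integral_cmult[symmetric]) (simp cong: measurable_cong_sets)
  also have "\<dots> = (\<integral>\<^sup>+z'. emeasure (distr (law (Suc l) z') paths (case_nat z))
       (prod_emb UNIV (\<lambda>_. S) J (PiE J E)) \<partial>K l z)"
  proof (rule nn_integral_cong)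
    fix z' assume "z' \<in> space (K l z)"
    then have z': "z' \<in> space S" using K_space[OF z] by simp
    have "case_nat z -` prod_emb UNIV (\<lambda>_. S) J (PiE J E) \<inter> space (law (Suc l) z') =
       (if z \<in> A 0 then {\<omega> \<in> space paths. \<forall>i<n. \<omega> i \<in> A (Suc i)} else {})"
      unfolding eq space_law[OF z'] using measurable_space[OF measurable_case_nat_path[OF z]]
      by (auto simp: less_Suc_eq_0_disj)
    moreover have "case_nat z \<in> law (Suc l) z' \<rightarrow>\<^sub>M paths"
      using measurable_case_nat_path[OF z] sets_law[OF z'] by (simp cong: measurable_cong_sets)
    ultimately show "indicator (A 0) z * cyl_weight n (\<lambda>i. A (Suc i)) (\<lambda>_. 1) (Suc l) z' =
        emeasure (distr (law (Suc l) z') paths (case_nat z)) (prod_emb UNIV (\<lambda>_. S) J (PiE J E))"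
      using meas by (simp add: emeasure_distr emeasure_law_cylinder[OF z' A'])
  qed
  also have "\<dots> = emeasure (K l z \<bind> (\<lambda>z'. distr (law (Suc l) z') paths (case_nat z)))
     (prod_emb UNIV (\<lambda>_. S) J (PiE J E))"
    by (rule emeasure_bind_prob_algebra[OF Kz m meas, symmetric])
  finally show "emeasure (law l z) (prod_emb UNIV (\<lambda>_. S) J (PiE J E)) = \<dots>" .
qed

lemma emeasure_law_first_step:
  assumes z: "z \<in> space S" and B: "Measurable.pred paths Q"
  shows "emeasure (law l z) {\<omega>\<in>space paths. Q \<omega>} =
    (\<integral>\<^sup>+z'. emeasure (law (Suc l) z') {\<omega>\<in>space paths. Q (case_nat z \<omega>)} \<partial>K l z)"
proof -
  have Kz: "K l z \<in> space (prob_algebra S)"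
    by (rule measurable_space[OF K z])
  have m: "(\<lambda>z'. distr (law (Suc l) z') paths (case_nat z)) \<in> S \<rightarrow>\<^sub>M prob_algebra paths"
    by (rule measurable_compose[OF measurable_law measurable_distr_prob_space[OF measurable_case_nat_path[OF z]]])
  have meas: "{\<omega>\<in>space paths. Q \<omega>} \<in> sets paths"
    using B by measurable
  have "emeasure (law l z) {\<omega>\<in>space paths. Q \<omega>} =
     (\<integral>\<^sup>+z'. emeasure (distr (law (Suc l) z') paths (case_nat z)) {\<omega>\<in>space paths. Q \<omega>} \<partial>K l z)"
    by (subst law_first_step[OF z]) (rule emeasure_bind_prob_algebra[OF Kz m meas])
  also have "\<dots> = (\<integral>\<^sup>+z'. emeasure (law (Suc l) z') {\<omega>\<in>space paths. Q (case_nat z \<omega>)} \<partial>K l z)"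
  proof (rule nn_integral_cong)
    fix z' assume "z' \<in> space (K l z)"
    then have z': "z' \<in> space S" using K_space[OF z] by simp
    have "case_nat z \<in> law (Suc l) z' \<rightarrow>\<^sub>M paths"
      using measurable_case_nat_path[OF z] sets_law[OF z'] by (simp cong: measurable_cong_sets)
    moreover have "case_nat z -` {\<omega>\<in>space paths. Q \<omega>} \<inter> space paths = {\<omega>\<in>space paths. Q (case_nat z \<omega>)}"
      using measurable_space[OF measurable_case_nat_path[OF z]] by auto
    ultimately show "emeasure (distr (law (Suc l) z') paths (case_nat z)) {\<omega>\<in>space paths. Q \<omega>} =
        emeasure (law (Suc l) z') {\<omega>\<in>space paths. Q (case_nat z \<omega>)}"
      using meas by (simp add: emeasure_distr space_law[OF z'])
  qed
  finally show ?thesis .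
qed

section \<open>Hitting times and infinitely many visits\<close>

lemma pred_ex_mem:
  assumes "G \<in> sets S"
  shows "Measurable.pred paths (\<lambda>\<omega>. \<exists>i. \<omega> i \<in> G)" "Measurable.pred paths (\<lambda>\<omega>. \<exists>i<n. \<omega> i \<in> G)"
    "Measurable.pred paths (\<lambda>\<omega>. \<forall>k::nat. \<exists>i\<ge>k. \<omega> i \<in> G)"
proof -
  note [measurable] = assms
  show "Measurable.pred paths (\<lambda>\<omega>. \<exists>i. \<omega> i \<in> G)" "Measurable.pred paths (\<lambda>\<omega>. \<exists>i<n. \<omega> i \<in> G)"
    "Measurable.pred paths (\<lambda>\<omega>. \<forall>k::nat. \<exists>i\<ge>k. \<omega> i \<in> G)"
    by measurable
qed

lemma emeasure_law_mono:
  assumes "z \<in> space S" "Measurable.pred paths R" "\<And>\<omega>. \<omega> \<in> space paths \<Longrightarrow> Q \<omega> \<Longrightarrow> R \<omega>"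
  shows "emeasure (law l z) {\<omega>\<in>space paths. Q \<omega>} \<le> emeasure (law l z) {\<omega>\<in>space paths. R \<omega>}"
  using assms by (intro emeasure_mono) (auto simp: sets_law)

lemma measurable_emeasure_law:
  assumes "z \<in> space S" "Measurable.pred paths Q"
  shows "(\<lambda>z'. emeasure (law l z') {\<omega>\<in>space paths. Q \<omega>}) \<in> borel_measurable (K i z)"
proof -
  have "(\<lambda>z'. emeasure (law l z') {\<omega>\<in>space paths. Q \<omega>}) \<in> borel_measurable S"
    using assms(2) by (intro measurable_compose[OF measurable_prob_algebraD[OF measurable_law]
        measurable_emeasure_subprob_algebra]) auto
  then show ?thesis
    using K_space(2)[OF assms(1), of i] by (simp cong: measurable_cong_sets)
qed

text \<open>This plays the part of the strong Markov property at the first visit to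
  \<open>G\<close>, by induction on the horizon. From a start in \<open>G\<close> the bound
  \<open>s\<close> applies at once; otherwise the first step is dropped, which \<open>Q\<close> does
  not notice by \<open>inv\<close>, and the induction hypothesis is integrated over the next
  state.\<close>

lemma emeasure_law_hitting_le_finite:
  assumes G: "G \<in> sets S" and Q: "Measurable.pred paths Q"
    and inv: "\<And>z \<omega>. Q (case_nat z \<omega>) \<longleftrightarrow> Q \<omega>"
    and s: "\<And>l z. l \<ge> l0 \<Longrightarrow> z \<in> G \<Longrightarrow> emeasure (law l z) {\<omega>\<in>space paths. Q \<omega>} \<le> s"
    and "l \<ge> l0" "z \<in> space S"
  shows "emeasure (law l z) {\<omega>\<in>space paths. Q \<omega> \<and> (\<exists>i<n. \<omega> i \<in> G)}
    \<le> s * emeasure (law l z) {\<omega>\<in>space paths. \<exists>i<n. \<omega> i \<in> G}"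
  using assms(5,6)
proof (induction n arbitrary: l z)
  case (Suc n)
  note hit = pred_ex_mem(2)[OF G] and z = \<open>z \<in> space S\<close>
  have QG: "Measurable.pred paths (\<lambda>\<omega>. Q \<omega> \<and> (\<exists>i<n. \<omega> i \<in> G))" for n
    by (rule pred_intros_logic(3)[OF Q hit])
  show ?case
  proof (cases "z \<in> G")
    case True
    have "emeasure (law l z) {\<omega>\<in>space paths. Q \<omega> \<and> (\<exists>i<Suc n. \<omega> i \<in> G)} \<le> s"
      by (rule order_trans[OF emeasure_law_mono[OF z Q] s[OF Suc.prems(1) True]]) simp
    \<comment> \<open>The factor 1 is rewritten as the probability of visiting \<open>G\<close>,
      which is certain because the start \<open>z\<close> already lies in \<open>G\<close>.\<close>
    also have "s = s * (\<integral>\<^sup>+z'. 1 \<partial>K l z)"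
      using prob_space.emeasure_space_1[OF K_space(1)[OF z, of l]] by simp
    also have "(\<integral>\<^sup>+z'. 1 \<partial>K l z) = (\<integral>\<^sup>+z'. emeasure (law (Suc l) z') {\<omega>\<in>space paths. \<exists>i<Suc n. case_nat z \<omega> i \<in> G} \<partial>K l z)"
    proof (rule nn_integral_cong)
      fix z' assume "z' \<in> space (K l z)"
      then have z': "z' \<in> space S" using K_space[OF z] by simp
      have "{\<omega>\<in>space paths. \<exists>i<Suc n. case_nat z \<omega> i \<in> G} = space (law (Suc l) z')"
        using True by (auto simp: space_law[OF z'])
      then show "1 = emeasure (law (Suc l) z') {\<omega>\<in>space paths. \<exists>i<Suc n. case_nat z \<omega> i \<in> G}"
        using prob_space.emeasure_space_1[OF prob_space_law[OF z']] by simp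
    qed
    also have "\<dots> = emeasure (law l z) {\<omega>\<in>space paths. \<exists>i<Suc n. \<omega> i \<in> G}"
      by (rule emeasure_law_first_step[OF z hit, symmetric])
    finally show ?thesis .
  next
    case False
    then have iff: "(\<exists>i<Suc n. case_nat z \<omega> i \<in> G) \<longleftrightarrow> (\<exists>i<n. \<omega> i \<in> G)" for \<omega>
      by (auto simp: less_Suc_eq_0_disj)
    have "emeasure (law l z) {\<omega>\<in>space paths. Q \<omega> \<and> (\<exists>i<Suc n. \<omega> i \<in> G)} =
       (\<integral>\<^sup>+z'. emeasure (law (Suc l) z') {\<omega>\<in>space paths. Q \<omega> \<and> (\<exists>i<n. \<omega> i \<in> G)} \<partial>K l z)"
      by (subst emeasure_law_first_step[OF z QG]) (simp add: inv iff)
    also have "\<dots> \<le> (\<integral>\<^sup>+z'. s * emeasure (law (Suc l) z') {\<omega>\<in>space paths. \<exists>i<n. \<omega> i \<in> G} \<partial>K l z)"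
      using Suc.prems K_space[OF z] by (intro nn_integral_mono Suc.IH) auto
    also have "\<dots> = s * (\<integral>\<^sup>+z'. emeasure (law (Suc l) z') {\<omega>\<in>space paths. \<exists>i<n. \<omega> i \<in> G} \<partial>K l z)"
      by (rule nn_integral_cmult[OF measurable_emeasure_law[OF z hit]])
    also have "\<dots> = s * emeasure (law l z) {\<omega>\<in>space paths. \<exists>i<Suc n. \<omega> i \<in> G}"
      by (subst emeasure_law_first_step[OF z hit]) (simp add: iff)
    finally show ?thesis .
  qed
qed simp

text \<open>Continuity from below as the horizon grows.\<close>

lemma emeasure_law_hitting_le:
  assumes G: "G \<in> sets S" and Q: "Measurable.pred paths Q"
    and inv: "\<And>z \<omega>. Q (case_nat z \<omega>) \<longleftrightarrow> Q \<omega>"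
    and s: "\<And>l z. l \<ge> l0 \<Longrightarrow> z \<in> G \<Longrightarrow> emeasure (law l z) {\<omega>\<in>space paths. Q \<omega>} \<le> s"
    and l: "l \<ge> l0" and z: "z \<in> space S"
  shows "emeasure (law l z) {\<omega>\<in>space paths. Q \<omega> \<and> (\<exists>i. \<omega> i \<in> G)}
    \<le> s * emeasure (law l z) {\<omega>\<in>space paths. \<exists>i. \<omega> i \<in> G}"
proof -
  note hit = pred_ex_mem(2)[OF G]
  let ?F = "\<lambda>n. {\<omega>\<in>space paths. Q \<omega> \<and> (\<exists>i<n. \<omega> i \<in> G)}"
  have "(\<Union>n. ?F n) = {\<omega>\<in>space paths. Q \<omega> \<and> (\<exists>i. \<omega> i \<in> G)}"
    by auto
  moreover have "?F n \<in> sets (law l z)" for n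
    using pred_intros_logic(3)[OF Q hit[of n]] unfolding sets_law[OF z] by (simp add: pred_def)
  then have "range ?F \<subseteq> sets (law l z)"
    by blast
  moreover have "incseq ?F"
  proof (rule incseq_SucI)
    fix n show "?F n \<subseteq> ?F (Suc n)"
      using less_SucI by blast
  qed
  ultimately have "emeasure (law l z) {\<omega>\<in>space paths. Q \<omega> \<and> (\<exists>i. \<omega> i \<in> G)} = (SUP n. emeasure (law l z) (?F n))"
    using SUP_emeasure_incseq[of ?F "law l z"] by simp
  also have "\<dots> \<le> s * emeasure (law l z) {\<omega>\<in>space paths. \<exists>i. \<omega> i \<in> G}"
  proof (rule SUP_least)
    fix n
    have "emeasure (law l z) (?F n) \<le> s * emeasure (law l z) {\<omega>\<in>space paths. \<exists>i<n. \<omega> i \<in> G}"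
      by (rule emeasure_law_hitting_le_finite[OF G Q inv s l z])
    also have "\<dots> \<le> s * emeasure (law l z) {\<omega>\<in>space paths. \<exists>i. \<omega> i \<in> G}"
      by (intro mult_left_mono emeasure_law_mono z pred_ex_mem(1) G) auto
    finally show "emeasure (law l z) (?F n) \<le> \<dots>" .
  qed
  finally show ?thesis .
qed

text \<open>A contraction argument on the supremum \<open>s\<close>. From \<open>D\<close>, the
  event requires a visit to \<open>G\<close>, of probability at most \<open>q\<close>, after which
  \<open>s\<close> still bounds what remains; waiting for the visit to \<open>D\<close> extends the
  bound \<open>s * q\<close> to every start.\<close>

lemma emeasure_law_io_both_eq_0:
  assumes D: "D \<in> sets S" and G: "G \<in> sets S" and "q < 1"
    and q: "\<And>l z. l \<ge> l0 \<Longrightarrow> z \<in> D \<Longrightarrow> emeasure (law l z) {\<omega>\<in>space paths. \<exists>i. \<omega> i \<in> G} \<le> q"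
    and z: "z \<in> space S"
  shows "emeasure (law 0 z)
    {\<omega>\<in>space paths. (\<forall>k::nat. \<exists>i\<ge>k. \<omega> i \<in> D) \<and> (\<forall>k::nat. \<exists>i\<ge>k. \<omega> i \<in> G)} = 0"
proof -
  define Q where "Q = (\<lambda>\<omega>. (\<forall>k::nat. \<exists>i\<ge>k. \<omega> i \<in> D) \<and> (\<forall>k::nat. \<exists>i\<ge>k. \<omega> i \<in> G))"
  have Q: "Measurable.pred paths Q"
    unfolding Q_def by (rule pred_intros_logic(3)[OF pred_ex_mem(3)[OF D] pred_ex_mem(3)[OF G]])
  have io: "(\<forall>k::nat. \<exists>i\<ge>k. case_nat z \<omega> i \<in> A) \<longleftrightarrow> (\<forall>k::nat. \<exists>i\<ge>k. \<omega> i \<in> A)" (is "?l \<longleftrightarrow> ?r")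
    for z \<omega> and A :: "'s set"
  proof (intro iffI allI)
    fix k :: nat assume ?l
    from spec[OF this, of "Suc k"] obtain i where "i \<ge> Suc k" "case_nat z \<omega> i \<in> A"
      by (elim exE conjE)
    then have "i - 1 \<ge> k \<and> \<omega> (i - 1) \<in> A" by (cases i) simp_all
    then show "\<exists>i\<ge>k. \<omega> i \<in> A" ..
  next
    fix k :: nat assume ?r
    from spec[OF this, of k] obtain i where "i \<ge> k" "\<omega> i \<in> A"
      by (elim exE conjE)
    then show "\<exists>i\<ge>k. case_nat z \<omega> i \<in> A" by (intro exI[of _ "Suc i"]) simp
  qed
  have inv: "Q (case_nat z \<omega>) \<longleftrightarrow> Q \<omega>" for z \<omega>
    unfolding Q_def io ..
  have Q_hits: "Q \<omega> \<Longrightarrow> \<exists>i. \<omega> i \<in> D" "Q \<omega> \<Longrightarrow> \<exists>i. \<omega> i \<in> G" for \<omega>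
    unfolding Q_def by blast+
  define p where "p l z = emeasure (law l z) {\<omega>\<in>space paths. Q \<omega>}" for l z
  define s where "s = (SUP (l, z) \<in> {l0..} \<times> space S. p l z)"
  have p_le: "p l z \<le> s" if "l \<ge> l0" "z \<in> space S" for l z
    unfolding s_def using that by (intro SUP_upper2[of "(l, z)"]) auto
  have p_D: "p l z \<le> s * q" if "l \<ge> l0" "z \<in> D" for l z
  proof -
    have z: "z \<in> space S" using that D[THEN sets.sets_into_space] by auto
    have "p l z \<le> emeasure (law l z) {\<omega>\<in>space paths. Q \<omega> \<and> (\<exists>i. \<omega> i \<in> G)}"
      unfolding p_def by (rule emeasure_law_mono[OF z pred_intros_logic(3)[OF Q pred_ex_mem(1)[OF G]]])
        (simp add: Q_hits)
    also have "\<dots> \<le> s * emeasure (law l z) {\<omega>\<in>space paths. \<exists>i. \<omega> i \<in> G}"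
      using p_le G[THEN sets.sets_into_space]
      by (intro emeasure_law_hitting_le[OF G Q inv _ that(1) z]) (simp add: p_def[symmetric] subset_iff)
    also have "\<dots> \<le> s * q"
      by (intro mult_left_mono q that) simp
    finally show ?thesis .
  qed
  have p_all: "p l z \<le> s * q" if "l \<ge> l0" "z \<in> space S" for l z
  proof -
    have "p l z \<le> emeasure (law l z) {\<omega>\<in>space paths. Q \<omega> \<and> (\<exists>i. \<omega> i \<in> D)}"
      unfolding p_def by (rule emeasure_law_mono[OF that(2) pred_intros_logic(3)[OF Q pred_ex_mem(1)[OF D]]])
        (simp add: Q_hits)
    also have "\<dots> \<le> s * q * emeasure (law l z) {\<omega>\<in>space paths. \<exists>i. \<omega> i \<in> D}"
      using p_D by (intro emeasure_law_hitting_le[OF D Q inv _ that]) (simp add: p_def[symmetric])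
    also have "\<dots> \<le> s * q * 1"
      by (intro mult_left_mono prob_space.emeasure_le_1 prob_space_law that) simp
    finally show ?thesis by simp
  qed
  have "s \<le> s * q"
    by (subst s_def, rule SUP_least) (auto simp: p_all)
  have "s \<le> 1"
    unfolding s_def p_def by (intro SUP_least) (auto intro!: prob_space.emeasure_le_1 prob_space_law)
  have "s = 0"
  proof (rule ccontr)
    assume "s \<noteq> 0"
    \<comment> \<open>Multiplication by \<open>s\<close> preserves strict inequality in
      \<open>ennreal\<close> only because \<open>s\<close> is nonzero and, by
      \<open>s \<le> 1\<close>, finite.\<close>
    have "s * q < s * 1"
      using \<open>q < 1\<close> \<open>s \<le> 1\<close> \<open>s \<noteq> 0\<close>
      by (intro ennreal_mult_strict_left_mono) (auto simp: less_top zero_less_iff_neq_zero le_less_trans)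
    with \<open>s \<le> s * q\<close> show False by simp
  qed
  then have p0: "p l z = 0" if "l \<ge> l0" "z \<in> space S" for l z
    using p_le[OF that] by simp
  \<comment> \<open>So far only clock times from \<open>l0\<close> on are covered. Shift invariance
    of \<open>Q\<close> lets the value 0 be carried back one step at a time.\<close>
  have "\<forall>z\<in>space S. p 0 z = 0"
  proof (rule inc_induct[of 0 l0])
    fix n assume IH: "\<forall>z\<in>space S. p (Suc n) z = 0"
    show "\<forall>z\<in>space S. p n z = 0"
    proof
      fix z assume z: "z \<in> space S"
      have "p n z = (\<integral>\<^sup>+z'. p (Suc n) z' \<partial>K n z)"
        unfolding p_def by (subst emeasure_law_first_step[OF z Q]) (simp add: inv)
      also have "\<dots> = (\<integral>\<^sup>+z'. 0 \<partial>K n z)"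
        using IH K_space[OF z] by (intro nn_integral_cong) auto
      finally show "p n z = 0" by simp
    qed
  qed (auto simp: p0)
  with z have "p 0 z = 0" by blast
  then show ?thesis
    unfolding p_def Q_def .
qed

section \<open>Almost sure properties of the start and of the transitions\<close>

lemma emeasure_law_start:
  assumes P: "Measurable.pred S P" and z: "z \<in> space S"
  shows "emeasure (law l z) {\<omega>\<in>space paths. P (\<omega> 0)} = indicator {z. P z} z"
proof -
  have "Measurable.pred paths (\<lambda>\<omega>. P (\<omega> 0))"
    by (rule measurable_compose[of "\<lambda>\<omega>. \<omega> 0" paths S, OF measurable_component_singleton P]) simp
  then have "emeasure (law l z) {\<omega>\<in>space paths. P (\<omega> 0)} =
      (\<integral>\<^sup>+z'. emeasure (law (Suc l) z') {\<omega>\<in>space paths. P z} \<partial>K l z)"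
    by (subst emeasure_law_first_step[OF z]) simp_all
  also have "\<dots> = (\<integral>\<^sup>+z'. indicator {z. P z} z \<partial>K l z)"
  proof (rule nn_integral_cong)
    fix z' assume "z' \<in> space (K l z)"
    then have "z' \<in> space S" using K_space[OF z] by simp
    from prob_space.emeasure_space_1[OF prob_space_law[OF this, of "Suc l"]] space_law[OF this, of "Suc l"]
    show "emeasure (law (Suc l) z') {\<omega>\<in>space paths. P z} = indicator {z. P z} z"
      by (cases "P z") auto
  qed
  also have "\<dots> = indicator {z. P z} z"
    using prob_space.emeasure_space_1[OF K_space(1)[OF z, of l]] by simp
  finally show ?thesis .
qed

lemma AE_law_iff:
  assumes "Measurable.pred paths Q" "z \<in> space S"
  shows "(AE \<omega> in law l z. Q \<omega>) \<longleftrightarrow> emeasure (law l z) {\<omega>\<in>space paths. \<not> Q \<omega>} = 0"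
  using assms by (subst AE_iff_measurable[OF _ refl]) (auto simp: sets_law space_law)

lemma AE_law_start:
  assumes P: "Measurable.pred S P" and z: "z \<in> space S" and "P z"
  shows "AE \<omega> in law l z. P (\<omega> 0)"
proof -
  have "Measurable.pred paths (\<lambda>\<omega>. P (\<omega> 0))"
    by (rule measurable_compose[of "\<lambda>\<omega>. \<omega> 0" paths S, OF measurable_component_singleton P]) simp
  moreover have "Measurable.pred S (\<lambda>z. \<not> P z)"
    using P by simp
  ultimately show ?thesis
    using emeasure_law_start[of "\<lambda>z. \<not> P z" z l] \<open>P z\<close> z by (subst AE_law_iff) simp_all
qed

text \<open>Lifts a relation from single kernels to whole paths. For the transition at coordinate 0
  the first-step formula reduces to \<open>K l z\<close>; each later transition is one coordinate
  earlier under \<open>law (Suc l)\<close>, and the clock index \<open>n + l\<close> of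
  \<open>R\<close> is unchanged by this.\<close>

lemma AE_law_transition:
  assumes R: "\<And>i. Measurable.pred (S \<Otimes>\<^sub>M S) (\<lambda>(z, z'). R i z z')"
    and AE_K: "\<And>i z. z \<in> space S \<Longrightarrow> AE z' in K i z. R i z z'"
    and z: "z \<in> space S"
  shows "AE \<omega> in law l z. \<forall>n. R (n + l) (\<omega> n) (\<omega> (Suc n))"
  unfolding AE_all_countable
proof
  fix n
  have pred': "Measurable.pred paths (\<lambda>\<omega>. R i (\<omega> n) (\<omega> (Suc n)))" for i n
  proof -
    have "(\<lambda>\<omega>. (\<omega> n, \<omega> (Suc n))) \<in> paths \<rightarrow>\<^sub>M S \<Otimes>\<^sub>M S"
      by (intro measurable_Pair measurable_component_singleton) auto
    from measurable_compose[OF this R[of i]] show ?thesis by simp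
  qed
  note pred = pred_intros_logic(2)[OF pred']
  have "emeasure (law l z) {\<omega>\<in>space paths. \<not> R (n + l) (\<omega> n) (\<omega> (Suc n))} = 0"
    using z
  proof (induction n arbitrary: l z)
    case (0 l z)
    have Rz: "Measurable.pred S (\<lambda>z'. \<not> R l z z')"
      using measurable_compose[OF measurable_Pair1'[OF 0] R[of l]] by simp
    have "emeasure (law l z) {\<omega>\<in>space paths. \<not> R l (\<omega> 0) (\<omega> (Suc 0))} =
        (\<integral>\<^sup>+z'. emeasure (law (Suc l) z') {\<omega>\<in>space paths. \<not> R l z (\<omega> 0)} \<partial>K l z)"
      by (subst emeasure_law_first_step[OF 0 pred]) simp
    also have "\<dots> = (\<integral>\<^sup>+z'. indicator {z'. \<not> R l z z'} z' \<partial>K l z)"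
      using K_space[OF 0] by (intro nn_integral_cong emeasure_law_start[OF Rz]) simp
    also have "\<dots> = (\<integral>\<^sup>+z'. 0 \<partial>K l z)"
      using AE_K[OF 0, of l] by (intro nn_integral_cong_AE) auto
    finally show ?case by simp
  next
    case (Suc n)
    have "emeasure (law l z) {\<omega>\<in>space paths. \<not> R (Suc n + l) (\<omega> (Suc n)) (\<omega> (Suc (Suc n)))} =
        (\<integral>\<^sup>+z'. emeasure (law (Suc l) z') {\<omega>\<in>space paths. \<not> R (n + Suc l) (\<omega> n) (\<omega> (Suc n))} \<partial>K l z)"
      by (subst emeasure_law_first_step[OF Suc.prems pred]) simp
    also have "\<dots> = (\<integral>\<^sup>+z'. 0 \<partial>K l z)"
      using K_space[OF Suc.prems] by (intro nn_integral_cong Suc.IH) auto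
    finally show ?case by simp
  qed
  then show "AE \<omega> in law l z. R (n + l) (\<omega> n) (\<omega> (Suc n))"
    by (rule AE_law_iff[OF pred' z, THEN iffD2])
qed

end
section \<open>Stability of the perturbed recursion\<close>

text \<open>Only \<open>x\<close> has to lie in \<open>K\<close>: some closed neighbourhood of
  \<open>K\<close> stays inside \<open>U\<close> and is compact, being the sum of \<open>K\<close>
  and a ball, so \<open>f\<close> is uniformly continuous on it.\<close>

lemma compact_uniform_nbhd:
  fixes f :: "'a::euclidean_space \<Rightarrow> 'b::metric_space"
  assumes "compact K" "open U" "K \<subseteq> U" "continuous_on U f" "e > 0"
  obtains r where "r > 0" "\<And>x y. x \<in> K \<Longrightarrow> dist y x \<le> r \<Longrightarrow> y \<in> U \<and> dist (f y) (f x) < e"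
proof -
  obtain r0 where r0: "r0 > 0" "(\<Union>x\<in>K. cball x r0) \<subseteq> U"
    using compact_subset_open_imp_cball_epsilon_subset[OF assms(1-3)] .
  let ?N = "(\<Union>x\<in>K. cball x r0)"
  have "?N = (\<Union>x\<in>K. \<Union>y\<in>cball 0 r0. {x + y})"
  proof (intro SUP_cong)
    fix x :: 'a
    show "cball x r0 = (\<Union>y\<in>cball 0 r0. {x + y})"
      using cball_translation[of x 0 r0] by (auto simp: image_def)
  qed simp
  then have "compact ?N"
    using compact_sums'[OF assms(1) compact_cball[of "0::'a" r0]] by simp
  then have "uniformly_continuous_on ?N f"
    using assms(4) r0(2) by (intro compact_uniformly_continuous continuous_on_subset[OF assms(4)])
  then obtain d where d: "d > 0" "\<And>x y. x \<in> ?N \<Longrightarrow> y \<in> ?N \<Longrightarrow> dist y x < d \<Longrightarrow> dist (f y) (f x) < e"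
    unfolding uniformly_continuous_on_def using \<open>e > 0\<close> by metis
  show thesis
  proof (rule that[of "min r0 (d/2)"])
    show "min r0 (d/2) > 0" using r0 d by simp
    fix x y assume "x \<in> K" and y: "dist y x \<le> min r0 (d/2)"
    then have "x \<in> ?N" "y \<in> ?N"
      using r0(1) \<open>x \<in> K\<close> by (auto simp: dist_commute intro!: bexI[of _ x])
    moreover have "dist y x < d" using y d(1) by simp
    ultimately show "y \<in> U \<and> dist (f y) (f x) < e"
      using r0(2) d(2) by blast
  qed
qed

text \<open>Compare \<open>t\<close> with the noise-free sum \<open>u\<close>, which is within
  \<epsilon> of \<open>t\<close> as long as \<open>t\<close> has stayed in the sublevel set. The
  increments of \<open>u\<close> point along \<open>h (t k)\<close>. They do not raise
  \<open>w\<close> when \<open>w (t k) > m\<close>, and from lower points one increment is too short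
  to reach \<open>M\<close>.\<close>

lemma stable_recursion:
  fixes \<Theta> :: "'a::euclidean_space set" and w :: "'a \<Rightarrow> real" and g h :: "'a \<Rightarrow> 'a" and m M :: real
  assumes "open \<Theta>" and w: "\<And>x. x \<in> \<Theta> \<Longrightarrow> GDERIV w x :> g x"
    and g: "continuous_on \<Theta> g" and h: "continuous_on \<Theta> h"
    and K: "compact {x \<in> \<Theta>. w x \<le> M}" and "m < M"
    and neg: "\<And>x. x \<in> \<Theta> \<Longrightarrow> m \<le> w x \<Longrightarrow> w x \<le> M \<Longrightarrow> g x \<bullet> h x < 0"
  obtains \<epsilon> \<delta> where "\<epsilon> > 0" "\<delta> > 0"
    "\<And>(t :: nat \<Rightarrow> 'a) c n. \<lbrakk>t 0 \<in> \<Theta>; w (t 0) \<le> m; \<forall>i. 0 \<le> c i \<and> c i \<le> \<delta>;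
        \<forall>k\<ge>1. (\<forall>i<k. t i \<in> \<Theta> \<and> w (t i) \<le> M) \<longrightarrow>
          norm (t k - t 0 - (\<Sum>i<k. c i *\<^sub>R h (t i))) \<le> \<epsilon>\<rbrakk> \<Longrightarrow>
      t n \<in> \<Theta> \<and> w (t n) \<le> M"
proof -
  define K where "K = {x \<in> \<Theta>. w x \<le> M}"
  \<comment> \<open>One third of the gap bounds the rise of \<open>w (u n)\<close> above
    \<open>w (t k)\<close> when \<open>w (t k) \<le> m\<close>, and another the passage from
    \<open>u n\<close> back to \<open>t n\<close>.\<close>
  define \<eta> where "\<eta> = (M - m) / 3"
  have \<eta>: "\<eta> > 0" using \<open>m < M\<close> by (simp add: \<eta>_def)
  have K\<Theta>: "K \<subseteq> \<Theta>" and cK: "compact K" using K by (auto simp: K_def)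
  have cw: "continuous_on \<Theta> w"
    using w by (intro continuous_at_imp_continuous_on ballI) (auto simp: gderiv_def intro: has_derivative_continuous)
  have "compact (h ` K)" using cK continuous_on_subset[OF h K\<Theta>] by (rule compact_continuous_image[rotated])
  then have "\<exists>B>0. \<forall>y\<in>h ` K. norm y \<le> B"
    by (intro bounded_pos[THEN iffD1] compact_imp_bounded)
  then obtain B where B: "B > 0" "\<And>x. x \<in> K \<Longrightarrow> norm (h x) \<le> B"
    by auto
  \<comment> \<open>Compactness of the layer between the levels \<open>m\<close> and
    \<open>M\<close> makes the decrease uniform; if the layer is empty, any positive
    \<open>d\<close> will do.\<close>
  obtain d where d: "d > 0" "\<And>x. x \<in> K \<Longrightarrow> m \<le> w x \<Longrightarrow> g x \<bullet> h x \<le> - d"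
  proof -
    define Km where "Km = K \<inter> {x \<in> \<Theta>. w x \<in> {m..}}"
    have "closedin (top_of_set K) (K \<inter> w -` {m..})"
      by (rule continuous_closedin_preimage[OF continuous_on_subset[OF cw K\<Theta>]]) simp
    then have "compact (K \<inter> w -` {m..})"
      by (rule closedin_compact[OF cK])
    also have "K \<inter> w -` {m..} = Km"
      using K\<Theta> by (auto simp: Km_def)
    finally have "compact Km" .
    show thesis
    proof (cases "Km = {}")
      case True
      then show ?thesis using that[of 1] K\<Theta> by (auto simp: Km_def)
    next
      case False
      have "continuous_on Km (\<lambda>x. g x \<bullet> h x)"
        using K\<Theta> by (intro continuous_on_inner continuous_on_subset[OF g] continuous_on_subset[OF h]) (auto simp: Km_def)
      from continuous_attains_sup[OF \<open>compact Km\<close> False this]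
      obtain x where x: "x \<in> Km" "\<And>y. y \<in> Km \<Longrightarrow> g y \<bullet> h y \<le> g x \<bullet> h x"
        by auto
      then have "g x \<bullet> h x < 0" using neg by (auto simp: Km_def K_def)
      with x that[of "- (g x \<bullet> h x)"] K\<Theta> show ?thesis by (auto simp: Km_def)
    qed
  qed
  obtain r1 where r1: "r1 > 0" "\<And>x y. x \<in> K \<Longrightarrow> dist y x \<le> r1 \<Longrightarrow> y \<in> \<Theta> \<and> dist (w y) (w x) < \<eta>"
    by (rule compact_uniform_nbhd[OF cK \<open>open \<Theta>\<close> K\<Theta> cw \<eta>]) blast
  obtain r2 where r2: "r2 > 0" "\<And>x y. x \<in> K \<Longrightarrow> dist y x \<le> r2 \<Longrightarrow> y \<in> \<Theta> \<and> dist (g y) (g x) < d / B"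
    \<comment> \<open>With \<open>B\<close> bounding \<open>h\<close> on \<open>K\<close>, a change
      of \<open>g\<close> below \<open>d / B\<close> costs at most \<open>d\<close> in the inner
      product with \<open>h (t k)\<close>.\<close>
    by (rule compact_uniform_nbhd[OF cK \<open>open \<Theta>\<close> K\<Theta> g, of "d / B"]) (use d(1) B(1) in auto)
  \<comment> \<open>A point between \<open>u k\<close> and \<open>u (Suc k)\<close> is within
    2\<epsilon> of \<open>t k\<close>: \<epsilon> for the noise and \<epsilon> for the increment,
    whose length is at most \<open>\<delta> * B\<close>.\<close>
  define \<epsilon> where "\<epsilon> = min r1 r2 / 2"
  define \<delta> where "\<delta> = \<epsilon> / B"
  have \<epsilon>: "\<epsilon> > 0" using r1(1) r2(1) by (simp add: \<epsilon>_def)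
  have \<delta>: "\<delta> > 0" using \<epsilon> B(1) by (simp add: \<delta>_def)
  show thesis
  proof (rule that[OF \<epsilon> \<delta>])
    fix t :: "nat \<Rightarrow> 'a" and c :: "nat \<Rightarrow> real" and n
    assume t0: "t 0 \<in> \<Theta>" "w (t 0) \<le> m" and c: "\<forall>i. 0 \<le> c i \<and> c i \<le> \<delta>"
      and noise: "\<forall>k\<ge>1. (\<forall>i<k. t i \<in> \<Theta> \<and> w (t i) \<le> M) \<longrightarrow>
          norm (t k - t 0 - (\<Sum>i<k. c i *\<^sub>R h (t i))) \<le> \<epsilon>"
    define u where "u k = t 0 + (\<Sum>i<k. c i *\<^sub>R h (t i))" for k
    have close: "dist (u k) (t k) \<le> \<epsilon>" if "\<And>i. i < k \<Longrightarrow> t i \<in> K" for k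
      using noise[rule_format, of k] that \<epsilon> by (cases "k = 0") (auto simp: u_def K_def dist_norm norm_minus_commute algebra_simps)
    \<comment> \<open>The induction controls \<open>w\<close> along \<open>u\<close>, for which
      descent can be shown, with a margin \<eta> that pays for returning to
      \<open>t\<close>.\<close>
    have "t n \<in> K \<and> w (u n) \<le> M - \<eta>"
    proof (induction n rule: less_induct)
      case (less n)
      show ?case
      proof (cases n)
        case 0
        then show ?thesis using t0 \<open>m < M\<close> by (auto simp: K_def u_def \<eta>_def field_simps)
      next
        case (Suc k)
        have tk: "t k \<in> K" and uk: "w (u k) \<le> M - \<eta>" using less Suc by auto
        have ck: "dist (u k) (t k) \<le> \<epsilon>" using less Suc by (intro close) auto
        have cn: "dist (u n) (t n) \<le> \<epsilon>" using less by (intro close) auto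
        have un: "u n = u k + c k *\<^sub>R h (t k)" by (simp add: u_def Suc)
        have "norm (c k *\<^sub>R h (t k)) \<le> \<delta> * B"
          using spec[OF c, of k] B(2)[OF tk] by (auto intro!: mult_mono)
        also have "\<dots> = \<epsilon>" using B(1) by (simp add: \<delta>_def)
        finally have incr: "norm (c k *\<^sub>R h (t k)) \<le> \<epsilon>" .
        have seg: "dist (u k + s *\<^sub>R (c k *\<^sub>R h (t k))) (t k) \<le> 2 * \<epsilon>" if "0 \<le> s" "s \<le> 1" for s
        proof -
          have "dist (u k + s *\<^sub>R (c k *\<^sub>R h (t k))) (t k) \<le> norm (u k - t k) + norm (s *\<^sub>R (c k *\<^sub>R h (t k)))"
            unfolding dist_norm using norm_triangle_ineq[of "u k - t k" "s *\<^sub>R (c k *\<^sub>R h (t k))"] by (simp add: algebra_simps)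
          moreover have "norm (s *\<^sub>R (c k *\<^sub>R h (t k))) \<le> 1 * \<epsilon>"
            using that incr by (subst norm_scaleR, intro mult_mono) auto
          ultimately show ?thesis using ck by (simp add: dist_norm)
        qed
        have seg1: "dist (u k + s *\<^sub>R (c k *\<^sub>R h (t k))) (t k) \<le> r1"
          and seg2: "dist (u k + s *\<^sub>R (c k *\<^sub>R h (t k))) (t k) \<le> r2" if "0 \<le> s" "s \<le> 1" for s
          using seg[OF that] by (auto simp: \<epsilon>_def)
        have wn: "w (u n) \<le> M - \<eta>"
        proof (cases "w (t k) \<le> m")
          case True
          have "dist (w (u n)) (w (t k)) < \<eta>"
            using seg1[of 1] r1(2)[OF tk] by (simp add: un)
          with True have "w (u n) < m + \<eta>" by (auto simp: dist_real_def)
          also have "\<dots> \<le> M - \<eta>" using \<open>m < M\<close> by (simp add: \<eta>_def field_simps)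
          finally show ?thesis by simp
        next
          case False
          define \<phi> where "\<phi> s = w (u k + s *\<^sub>R (c k *\<^sub>R h (t k)))" for s :: real
          have der: "(\<phi> has_real_derivative (g (u k + s *\<^sub>R (c k *\<^sub>R h (t k))) \<bullet> (c k *\<^sub>R h (t k)))) (at s)"
            if "0 \<le> s" "s \<le> 1" for s
          proof -
            let ?x = "u k + s *\<^sub>R (c k *\<^sub>R h (t k))"
            have "(w has_derivative (\<lambda>v. v \<bullet> g ?x)) (at ?x)"
              using w[of ?x] r1(2)[OF tk seg1[OF that]] by (simp add: gderiv_def)
            moreover have "((\<lambda>s. u k + s *\<^sub>R (c k *\<^sub>R h (t k))) has_derivative (\<lambda>s. s *\<^sub>R (c k *\<^sub>R h (t k)))) (at s)"
              by (auto intro!: derivative_eq_intros)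
            ultimately have "((\<lambda>s. w (u k + s *\<^sub>R (c k *\<^sub>R h (t k)))) has_derivative (\<lambda>v. (v *\<^sub>R (c k *\<^sub>R h (t k))) \<bullet> g ?x)) (at s)"
              by (rule has_derivative_compose[rotated])
            then show ?thesis
              unfolding has_field_derivative_def \<phi>_def
              by (rule has_derivative_eq_rhs) (auto simp: fun_eq_iff inner_commute)
          qed
          \<comment> \<open>By the mean value theorem the change of \<open>w\<close> is governed by
            the gradient at an intermediate point, which is close enough to \<open>t k\<close> for
            the descent there to survive.\<close>
          obtain s where s: "0 < s" "s < 1" "\<phi> 1 - \<phi> 0 = (1 - 0) * (g (u k + s *\<^sub>R (c k *\<^sub>R h (t k))) \<bullet> (c k *\<^sub>R h (t k)))"
            using MVT2[of 0 1 \<phi> "\<lambda>s. g (u k + s *\<^sub>R (c k *\<^sub>R h (t k))) \<bullet> (c k *\<^sub>R h (t k))"] der by auto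
          let ?x = "u k + s *\<^sub>R (c k *\<^sub>R h (t k))"
          have "g ?x \<bullet> h (t k) = g (t k) \<bullet> h (t k) + (g ?x - g (t k)) \<bullet> h (t k)"
            by (simp add: inner_diff_left)
          also have "(g ?x - g (t k)) \<bullet> h (t k) \<le> norm (g ?x - g (t k)) * norm (h (t k))"
            by (rule norm_cauchy_schwarz)
          also have "\<dots> \<le> d / B * B"
            using r2(2)[OF tk seg2[of s]] s B d(1) tk by (intro mult_mono) (auto simp: dist_norm)
          also have "\<dots> = d" using B(1) by simp
          also have "g (t k) \<bullet> h (t k) \<le> - d"
            using False by (intro d(2) tk) simp
          finally have "g ?x \<bullet> h (t k) \<le> 0" by simp
          then have "c k * (g ?x \<bullet> h (t k)) \<le> 0"
            using spec[OF c, of k] by (simp add: mult_nonneg_nonpos)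
          then have "w (u n) \<le> w (u k)"
            using s(3) by (simp add: \<phi>_def un)
          with uk show ?thesis by simp
        qed
        \<comment> \<open>This comes first because the radius \<open>r1\<close> applies around
          points of \<open>K\<close>; it is then used around \<open>u n\<close> to reach
          \<open>t n\<close>.\<close>
        have "u n \<in> K"
          using r1(2)[OF tk seg1[of 1]] wn \<eta> by (simp add: un K_def)
        moreover from this have "t n \<in> \<Theta> \<and> dist (w (t n)) (w (u n)) < \<eta>"
          using cn r1(1) by (intro r1(2)) (auto simp: dist_commute \<epsilon>_def)
        ultimately show ?thesis
          using wn by (auto simp: K_def dist_real_def)
      qed
    qed
    then show "t n \<in> \<Theta> \<and> w (t n) \<le> M" by (simp add: K_def)
  qed
qed

section \<open>Stochastic approximation\<close>

text \<open>\<open>gradient\<close> is a definite description, so existence and uniqueness are both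
  required: the representing vector is the adjoint of the derivative at 1, and derivatives are
  unique.\<close>

lemma GDERIV_gradient:
  fixes w :: "'a::euclidean_space \<Rightarrow> real"
  assumes "w differentiable (at x)"
  shows "GDERIV w x :> gradient w x"
proof -
  from assms obtain w' where w': "(w has_derivative w') (at x)"
    by (auto simp: differentiable_def)
  then have lin: "linear w'"
    by (simp add: has_derivative_linear)
  have "w' = (\<lambda>v. v \<bullet> adjoint w' 1)"
    using adjoint_works[OF lin, of _ 1] by (auto simp: fun_eq_iff)
  with w' have ex: "GDERIV w x :> adjoint w' 1"
    by (simp add: gderiv_def)
  have "D = adjoint w' 1" if "GDERIV w x :> D" for D
  proof -
    have "(\<lambda>v. v \<bullet> D) = (\<lambda>v. v \<bullet> adjoint w' 1)"
      using has_derivative_unique[OF that[unfolded gderiv_def] ex[unfolded gderiv_def]] .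
    then show ?thesis
      by (metis inner_commute vector_eq_rdot)
  qed
  with ex show ?thesis
    unfolding gradient_def by (metis theI)
qed

text \<open>Index \<open>k\<close> itself is unrestricted, so the stopped noise still includes the
  very step by which the trajectory would leave \<open>W\<close>.\<close>

lemma le_exit_time_iff: "enat k \<le> exit_time W \<omega> \<longleftrightarrow> (\<forall>j\<in>{1..<k}. fst (\<omega> j) \<in> W)"
proof -
  have "enat k \<le> exit_time W \<omega> \<longleftrightarrow> (\<forall>j\<ge>1. fst (\<omega> j) \<notin> W \<longrightarrow> k \<le> j)"
    unfolding exit_time_def le_Inf_iff by auto
  then show ?thesis
    by (metis atLeastLessThan_iff leD leI)
qed

text \<open>Shifting the step sizes amounts to starting the clock at \<open>l\<close>, so all
  shifted processes belong to one kernel family.\<close>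

lemma sa_law_shift_eq:
  "sa_law \<Theta> X P H (\<lambda>i. \<gamma> (i + l)) \<theta> x = markov_kernels.law (sa_space \<Theta> X) (sa_kernel \<Theta> X P H \<gamma>) l (\<theta>, x)"
  if "markov_kernels (sa_space \<Theta> X) (sa_kernel \<Theta> X P H \<gamma>)"
proof -
  interpret markov_kernels "sa_space \<Theta> X" "sa_kernel \<Theta> X P H \<gamma>" by fact
  have "sa_step \<Theta> X P H (\<lambda>i. \<gamma> (i + l)) \<theta> x = chain_step (sa_space \<Theta> X) (\<lambda>i. sa_kernel \<Theta> X P H \<gamma> (i + l)) (\<theta>, x)"
    by (intro ext) (simp add: sa_step_def chain_step_def sa_kernel_def split: nat.split)
  then show ?thesis
    by (simp add: sa_law_def law_def chain_law_def)
qed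

section \<open>State space, one-step dynamics and noise of the recursion\<close>

lemma space_sa_space: "space (sa_space \<Theta> X) = \<Theta> \<times> X"
  by (simp add: sa_space_def space_pair_measure space_restrict_space)

lemma measurable_sa_space_fst: "fst \<in> sa_space \<Theta> X \<rightarrow>\<^sub>M restrict_space borel \<Theta>"
  and measurable_sa_space_snd: "snd \<in> sa_space \<Theta> X \<rightarrow>\<^sub>M restrict_space borel X"
  by (simp_all add: sa_space_def)

lemma borel_measurable_sa_space_fst: "fst \<in> borel_measurable (sa_space \<Theta> X)"
  for \<Theta> :: "'a::topological_space set"
  by (rule measurable_compose[OF measurable_sa_space_fst measurable_restrict_space1]) simp

text \<open>The recursion pairs the old parameter with the new state, hence two maps
  \<open>f\<close> and \<open>g\<close>.\<close>

lemma borel_measurable_sa_field: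
  assumes H: "(\<lambda>(\<theta>, x). H \<theta> x) \<in> borel_measurable (sa_space \<Theta> X)"
    and f: "f \<in> N \<rightarrow>\<^sub>M sa_space \<Theta> X" and g: "g \<in> N \<rightarrow>\<^sub>M sa_space \<Theta> X"
  shows "(\<lambda>y. H (fst (f y)) (snd (g y))) \<in> borel_measurable N"
proof -
  have "(\<lambda>y. (fst (f y), snd (g y))) \<in> N \<rightarrow>\<^sub>M sa_space \<Theta> X"
    unfolding sa_space_def
    by (intro measurable_Pair measurable_compose[OF f measurable_sa_space_fst]
        measurable_compose[OF g measurable_sa_space_snd])
  from measurable_compose[OF this H] show ?thesis by simp
qed

text \<open>The kernel is the image of \<open>P \<theta> x\<close> under a map whose values all
  satisfy the recursion; the relation is measurable as the zero set of a measurable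
  difference.\<close>

lemma AE_sa_kernel:
  fixes \<Theta> :: "'a::euclidean_space set" and X :: "'b::euclidean_space set"
  assumes P: "(\<lambda>(\<theta>, x). P \<theta> x) \<in> sa_space \<Theta> X \<rightarrow>\<^sub>M prob_algebra (restrict_space borel X)"
    and H: "(\<lambda>(\<theta>, x). H \<theta> x) \<in> borel_measurable (sa_space \<Theta> X)"
    and \<Theta>: "\<And>\<theta> x. \<theta> \<in> \<Theta> \<Longrightarrow> x \<in> X \<Longrightarrow> \<theta> + \<gamma> (Suc i) *\<^sub>R H \<theta> x \<in> \<Theta>"
    and z: "z \<in> space (sa_space \<Theta> X)"
  shows "AE z' in sa_kernel \<Theta> X P H \<gamma> i z. fst z' = fst z + \<gamma> (Suc i) *\<^sub>R H (fst z) (snd z')"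
proof -
  obtain \<theta> x where z_eq: "z = (\<theta>, x)" and \<theta>: "\<theta> \<in> \<Theta>" and x: "x \<in> X"
    using z by (auto simp: space_sa_space)
  let ?X = "restrict_space borel X :: 'b measure"
  have sets_P: "sets (P \<theta> x) = sets ?X"
    using measurable_space[OF P z] by (simp add: z_eq space_prob_algebra)
  have "(\<lambda>x'. (\<theta>, x')) \<in> ?X \<rightarrow>\<^sub>M sa_space \<Theta> X"
    using \<theta> unfolding sa_space_def by (intro measurable_Pair) (auto simp: space_restrict_space)
  from measurable_compose[OF this H] have "(\<lambda>x'. H \<theta> x') \<in> borel_measurable ?X"
    by simp
  then have "(\<lambda>x'. \<theta> + \<gamma> (Suc i) *\<^sub>R H \<theta> x') \<in> borel_measurable ?X"
    by simp
  then have "(\<lambda>x'. \<theta> + \<gamma> (Suc i) *\<^sub>R H \<theta> x') \<in> ?X \<rightarrow>\<^sub>M restrict_space borel \<Theta>"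
    by (rule measurable_restrict_space2[rotated]) (auto simp: space_restrict_space intro!: \<Theta> \<theta>)
  then have f: "(\<lambda>x'. (\<theta> + \<gamma> (Suc i) *\<^sub>R H \<theta> x', x')) \<in> P \<theta> x \<rightarrow>\<^sub>M sa_space \<Theta> X"
    unfolding sa_space_def by (intro measurable_Pair) (simp_all cong: measurable_cong_sets add: sets_P)
  have "(\<lambda>z'. fst z' - (\<theta> + \<gamma> (Suc i) *\<^sub>R H \<theta> (snd z'))) \<in> borel_measurable (sa_space \<Theta> X)"
    using borel_measurable_sa_field[OF H measurable_const[OF z] measurable_ident]
    by (intro borel_measurable_diff borel_measurable_add borel_measurable_scaleR borel_measurable_const
        borel_measurable_sa_space_fst) (simp add: z_eq id_def)
  from measurable_sets[OF this, of "{0}"]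
  have "{z' \<in> space (sa_space \<Theta> X). fst z' = \<theta> + \<gamma> (Suc i) *\<^sub>R H \<theta> (snd z')} \<in> sets (sa_space \<Theta> X)"
    by (simp add: vimage_def Int_def conj_commute)
  moreover have kernel: "sa_kernel \<Theta> X P H \<gamma> i z = distr (P \<theta> x) (sa_space \<Theta> X) (\<lambda>x'. (\<theta> + \<gamma> (Suc i) *\<^sub>R H \<theta> x', x'))"
    by (simp add: sa_kernel_def z_eq)
  ultimately show ?thesis
    unfolding kernel by (subst AE_distr_iff[OF f]) (simp_all add: z_eq)
qed

text \<open>Each weighted noise term is an increment of the parameter minus the mean-field step, so
  the sum telescopes. This is the deviation that \<open>stable_recursion\<close> requires to be
  small.\<close>

lemma sum_noise_eq:
  assumes "\<And>i. i < k \<Longrightarrow> fst (\<omega> (Suc i)) = fst (\<omega> i) + c (Suc i) *\<^sub>R H (fst (\<omega> i)) (snd (\<omega> (Suc i)))"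
  shows "(\<Sum>j = 1..k. c j *\<^sub>R noise H h \<omega> j) = fst (\<omega> k) - fst (\<omega> 0) - (\<Sum>i<k. c (Suc i) *\<^sub>R h (fst (\<omega> i)))"
  using assms
proof (induction k)
  case (Suc k)
  have "(\<Sum>j = 1..Suc k. c j *\<^sub>R noise H h \<omega> j) =
     (\<Sum>j = 1..k. c j *\<^sub>R noise H h \<omega> j) + c (Suc k) *\<^sub>R noise H h \<omega> (Suc k)"
    by simp
  also have "(\<Sum>j = 1..k. c j *\<^sub>R noise H h \<omega> j) = fst (\<omega> k) - fst (\<omega> 0) - (\<Sum>i<k. c (Suc i) *\<^sub>R h (fst (\<omega> i)))"
    using Suc by simp
  finally show ?case
    using Suc.prems[of k] by (simp add: noise_def algebra_simps)
qed simp

text \<open>The exit time enters only through the events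
  \<open>enat k \<le> exit_time W \<omega>\<close>, each a condition on finitely many coordinates by
  \<open>le_exit_time_iff\<close>.\<close>

lemma pred_noise_event:
  assumes H: "(\<lambda>(\<theta>, x). H \<theta> x) \<in> borel_measurable (sa_space \<Theta> X)"
    and h: "h \<in> borel_measurable (restrict_space borel \<Theta>)"
    and W: "W \<in> sets (restrict_space borel \<Theta>)"
  shows "Measurable.pred (PiM UNIV (\<lambda>_. sa_space \<Theta> X)) (\<lambda>\<omega>.
    (SUP k\<in>{1..}. ereal (of_bool (enat k \<le> exit_time W \<omega>)
      * norm (\<Sum>j = 1..k. c j *\<^sub>R noise H h \<omega> j))) > ereal \<epsilon>)"
proof -
  let ?N = "PiM UNIV (\<lambda>_. sa_space \<Theta> X) :: (nat \<Rightarrow> 'a \<times> 'b) measure"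
  have comp: "(\<lambda>\<omega>. \<omega> i) \<in> ?N \<rightarrow>\<^sub>M sa_space \<Theta> X" for i
    by simp
  have comp_fst: "(\<lambda>\<omega>. fst (\<omega> i)) \<in> ?N \<rightarrow>\<^sub>M restrict_space borel \<Theta>" for i
    by (rule measurable_compose[OF comp measurable_sa_space_fst])
  have noise[measurable]: "(\<lambda>\<omega>. noise H h \<omega> j) \<in> borel_measurable ?N" for j
    unfolding noise_def
    by (intro borel_measurable_diff borel_measurable_sa_field[OF H comp comp] measurable_compose[OF comp_fst h])
  have [measurable]: "Measurable.pred ?N (\<lambda>\<omega>. fst (\<omega> j) \<in> W)" for j
    using measurable_compose[OF comp_fst[of j], of "\<lambda>\<theta>. \<theta> \<in> W" "count_space UNIV"] W by simp
  have "(\<lambda>\<omega>. SUP k\<in>{1..}. ereal (of_bool (enat k \<le> exit_time W \<omega>)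
      * norm (\<Sum>j = 1..k. c j *\<^sub>R noise H h \<omega> j))) \<in> borel_measurable ?N"
    unfolding le_exit_time_iff of_bool_def by measurable
  then show ?thesis
    by measurable
qed

section \<open>Almost sure stability of the recursion\<close>

theorem theorem3:
  fixes \<Theta> :: "(real ^ 'n) set" and X C :: "(real ^ 'm) set"
    and P :: "real ^ 'n \<Rightarrow> real ^ 'm \<Rightarrow> (real ^ 'm) measure"
    and \<pi> :: "real ^ 'n \<Rightarrow> (real ^ 'm) measure"
    and H :: "real ^ 'n \<Rightarrow> real ^ 'm \<Rightarrow> real ^ 'n"
    and h :: "real ^ 'n \<Rightarrow> real ^ 'n"
    and \<gamma> :: "nat \<Rightarrow> real"
    and w :: "real ^ 'n \<Rightarrow> real"
    and L :: "(real ^ 'n) set"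
    and M0 :: real and M1 M :: ereal
  assumes P_kernel: "(\<lambda>(\<theta>, x). P \<theta> x) \<in> sa_space \<Theta> X \<rightarrow>\<^sub>M prob_algebra (restrict_space borel X)"
    and \<pi>_prob: "\<forall>\<theta>\<in>\<Theta>. \<pi> \<theta> \<in> space (prob_algebra (restrict_space borel X))"
    and H_measurable: "(\<lambda>(\<theta>, x). H \<theta> x) \<in> borel_measurable (sa_space \<Theta> X)"
    and h_def: "h = mean_field \<pi> H"
    and A4_1: "\<exists>\<gamma>_plus>0. (\<forall>i. \<gamma> i \<in> {0..\<gamma>_plus}) \<and>
                 (\<forall>\<theta>\<in>\<Theta>. \<forall>x\<in>X. \<forall>c\<in>{0..\<gamma>_plus}. \<theta> + c *\<^sub>R H \<theta> x \<in> \<Theta>)"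
    and A4_2: "\<forall>\<theta>\<in>\<Theta>. (\<integral>\<^sup>+x. ennreal (norm (H \<theta> x)) \<partial>\<pi> \<theta>) < \<infinity>"
    and A4_3: "\<forall>\<theta>\<in>\<Theta>. \<pi> \<theta> \<bind> P \<theta> = \<pi> \<theta>"
    and A5_open: "open \<Theta>"
    and A5_h: "continuous_on \<Theta> h"
    and A5_w_nonneg: "\<forall>\<theta>\<in>\<Theta>. 0 \<le> w \<theta>"
    and A5_w_C1: "\<forall>\<theta>\<in>\<Theta>. w differentiable (at \<theta>)" "continuous_on \<Theta> (gradient w)"
    and L_def: "L = {\<theta> \<in> \<Theta>. gradient w \<theta> \<bullet> h \<theta> = 0}"
    and A5_1: "0 < M0" "L \<subseteq> {\<theta> \<in> \<Theta>. w \<theta> < M0}"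
    and A5_2: "ereal M0 < M1" "compact (sublevel \<Theta> w M1)"
    and A5_3: "\<forall>\<theta>\<in>\<Theta> - L. gradient w \<theta> \<bullet> h \<theta> < 0"
    and \<gamma>_limsup: "limsup (\<lambda>i. ereal (\<gamma> i)) = 0"
    and M: "ereal M0 < M" "M \<le> M1"
    and C: "C \<subseteq> X"
    and noise_small: "\<forall>\<epsilon>>0.
      limsup (\<lambda>l. SUP (\<theta>, x) \<in> sublevel \<Theta> w (ereal M0) \<times> C.
        ennreal (\<P>(\<omega> in sa_law \<Theta> X P H (\<lambda>i. \<gamma> (i + l)) \<theta> x.
          (SUP k\<in>{1..}. ereal (of_bool (enat k \<le> exit_time (sublevel \<Theta> w M) \<omega>)
             * norm (\<Sum>j = 1..k. \<gamma> (j + l) *\<^sub>R noise H h \<omega> j))) > ereal \<epsilon>))) < 1"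
    and recurrent: "\<forall>\<theta>\<in>\<Theta>. \<forall>x\<in>X.
      \<P>(\<omega> in sa_law \<Theta> X P H \<gamma> \<theta> x.
        \<forall>k\<ge>1. \<exists>i\<ge>k. \<omega> i \<in> sublevel \<Theta> w (ereal M0) \<times> C) = 1"
  shows "\<forall>\<theta>\<in>\<Theta>. \<forall>x\<in>X.
      \<P>(\<omega> in sa_law \<Theta> X P H \<gamma> \<theta> x.
        \<exists>k\<ge>1. \<forall>i\<ge>k. fst (\<omega> i) \<in> sublevel \<Theta> w M) = 1"
proof -
  let ?S = "sa_space \<Theta> X"
  let ?K = "sa_kernel \<Theta> X P H \<gamma>"
  let ?V = "sublevel \<Theta> w (ereal M0)"
  let ?W = "sublevel \<Theta> w M"
  have \<gamma>0: "0 \<le> \<gamma> i" for i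
    using A4_1 by auto
  have stay: "\<theta> + \<gamma> i *\<^sub>R H \<theta> x \<in> \<Theta>" if "\<theta> \<in> \<Theta>" "x \<in> X" for i \<theta> x
    using A4_1 that by auto
  interpret markov_kernels ?S ?K
    by unfold_locales (rule measurable_sa_kernel[OF P_kernel H_measurable stay])
  have law_shift: "sa_law \<Theta> X P H (\<lambda>i. \<gamma> (i + l)) \<theta> x = law l (\<theta>, x)" for l \<theta> x
    by (rule sa_law_shift_eq) unfold_locales
  have law_0: "sa_law \<Theta> X P H \<gamma> \<theta> x = law 0 (\<theta>, x)" for \<theta> x
    using law_shift[of 0] by simp
  have w_grad: "GDERIV w \<theta> :> gradient w \<theta>" if "\<theta> \<in> \<Theta>" for \<theta>
    using GDERIV_gradient A5_w_C1(1) that by auto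
  have w_cont: "continuous_on \<Theta> w"
    using w_grad by (intro continuous_at_imp_continuous_on ballI)
      (auto simp: gderiv_def intro: has_derivative_continuous)
  have borel_sublevel: "sublevel \<Theta> w r \<in> sets (restrict_space borel \<Theta>)" for r
  proof -
    have "(\<lambda>\<theta>. ereal (w \<theta>)) \<in> borel_measurable (restrict_space borel \<Theta>)"
      using borel_measurable_continuous_on_restrict[OF w_cont] by simp
    from measurable_sets[OF this, of "{..r}"] show ?thesis
      by (simp add: sublevel_def vimage_def Int_def space_restrict_space conj_commute)
  qed
  have h_borel: "h \<in> borel_measurable (restrict_space borel \<Theta>)"
    by (rule borel_measurable_continuous_on_restrict[OF A5_h])
  have pred_fst: "Measurable.pred ?S (\<lambda>z. fst z \<in> sublevel \<Theta> w r)" for r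
    using measurable_compose[OF measurable_sa_space_fst, of "\<lambda>\<theta>. \<theta> \<in> sublevel \<Theta> w r" \<Theta> "count_space UNIV" X]
      borel_sublevel[of r] by simp

  show ?thesis
  proof (intro ballI)
    fix \<theta> x assume \<theta>: "\<theta> \<in> \<Theta>" and x: "x \<in> X"
    then have z: "(\<theta>, x) \<in> space ?S"
      by (simp add: space_sa_space)
    interpret L: prob_space "law 0 (\<theta>, x)"
      by (rule prob_space_law[OF z])
    show "\<P>(\<omega> in sa_law \<Theta> X P H \<gamma> \<theta> x. \<exists>k\<ge>1. \<forall>i\<ge>k. fst (\<omega> i) \<in> ?W) = 1"
    proof (cases M)
      case MInf
      with M show ?thesis by simp
    next
      \<comment> \<open>At an infinite level the sublevel set is all of \<Theta>, so the event is
        the whole path space.\<close>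
      case PInf
      have "{\<omega> \<in> space (law 0 (\<theta>, x)). \<exists>k\<ge>1. \<forall>i\<ge>k. fst (\<omega> i) \<in> ?W} = space (law 0 (\<theta>, x))"
        using PInf by (auto simp: space_law[OF z] space_PiM PiE_iff space_sa_space sublevel_def mem_Times_iff)
      then show ?thesis
        by (simp add: law_0 L.prob_space)
    next
      case (real Mr)
      have W_eq: "?W = {\<theta> \<in> \<Theta>. w \<theta> \<le> Mr}"
        by (simp add: sublevel_def real)
      have W0_eq: "?V = {\<theta> \<in> \<Theta>. w \<theta> \<le> M0}"
        by (simp add: sublevel_def)
      have "M0 < Mr" using M(1) real by simp
      \<comment> \<open>Compactness is given at level \<open>M1\<close>; the set at level
        \<open>Mr\<close> is relatively closed in that one.\<close>
      have cW: "compact {\<theta> \<in> \<Theta>. w \<theta> \<le> Mr}"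
      proof -
        have "closedin (top_of_set (sublevel \<Theta> w M1)) (sublevel \<Theta> w M1 \<inter> w -` {..Mr})"
          by (rule continuous_closedin_preimage[OF continuous_on_subset[OF w_cont]]) (auto simp: sublevel_def)
        then have "compact (sublevel \<Theta> w M1 \<inter> w -` {..Mr})"
          by (rule closedin_compact[OF A5_2(2)])
        also have "sublevel \<Theta> w M1 \<inter> w -` {..Mr} = {\<theta> \<in> \<Theta>. w \<theta> \<le> Mr}"
        proof -
          have "ereal (w \<theta>) \<le> M1" if "w \<theta> \<le> Mr" for \<theta>
            using that M(2) real by (metis ereal_less_eq(3) order_trans)
          then show ?thesis by (auto simp: sublevel_def)
        qed
        finally show ?thesis .
      qed
      \<comment> \<open>\<open>L\<close> lies strictly below level \<open>M0\<close>, so points at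
        or above that level are outside \<open>L\<close>.\<close>
      have neg: "gradient w \<theta> \<bullet> h \<theta> < 0" if "\<theta> \<in> \<Theta>" "M0 \<le> w \<theta>" for \<theta>
        using A5_3 A5_1(2) that by force
      obtain \<epsilon> \<delta> where \<epsilon>: "\<epsilon> > 0" and \<delta>: "\<delta> > 0" and stable:
        "\<And>(t :: nat \<Rightarrow> real ^ 'n) c n. \<lbrakk>t 0 \<in> \<Theta>; w (t 0) \<le> M0; \<forall>i. 0 \<le> c i \<and> c i \<le> \<delta>;
          \<forall>k\<ge>1. (\<forall>i<k. t i \<in> \<Theta> \<and> w (t i) \<le> Mr) \<longrightarrow>
            norm (t k - t 0 - (\<Sum>i<k. c i *\<^sub>R h (t i))) \<le> \<epsilon>\<rbrakk> \<Longrightarrow> t n \<in> \<Theta> \<and> w (t n) \<le> Mr"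
        by (rule stable_recursion[OF A5_open w_grad A5_w_C1(2) A5_h cW \<open>M0 < Mr\<close> neg]) blast+
      define E where "E l \<omega> \<longleftrightarrow> (SUP k\<in>{1..}. ereal (of_bool (enat k \<le> exit_time ?W \<omega>)
             * norm (\<Sum>j = 1..k. \<gamma> (j + l) *\<^sub>R noise H h \<omega> j))) > ereal \<epsilon>" for l \<omega>
      have E_pred: "Measurable.pred paths (E l)" for l
        unfolding E_def by (rule pred_noise_event[OF H_measurable h_borel borel_sublevel])
      obtain q l1 where "q < 1" and q: "\<And>l \<theta> x. l \<ge> l1 \<Longrightarrow> \<theta> \<in> ?V \<Longrightarrow> x \<in> C \<Longrightarrow>
          emeasure (law l (\<theta>, x)) {\<omega>\<in>space paths. E l \<omega>} \<le> q"
      proof -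
        let ?s = "\<lambda>l. SUP (\<theta>, x) \<in> ?V \<times> C. ennreal (\<P>(\<omega> in law l (\<theta>, x). E l \<omega>))"
        have "limsup ?s < 1"
          using noise_small[rule_format, OF \<epsilon>] unfolding law_shift E_def .
        \<comment> \<open>A number strictly between the limsup and 1 serves as a uniform bound at
          all late times.\<close>
        then obtain q where "limsup ?s < q" "q < 1"
          using dense by blast
        from Limsup_lessD[OF this(1)] obtain l1 where l1: "\<And>l. l \<ge> l1 \<Longrightarrow> ?s l < q"
          by (auto simp: eventually_sequentially)
        show thesis
        proof (rule that[OF \<open>q < 1\<close>])
          fix l \<theta> x assume "l \<ge> l1" and \<theta>: "\<theta> \<in> ?V" and x: "x \<in> C"
          then have z: "(\<theta>, x) \<in> space ?S"
            using C by (auto simp: space_sa_space sublevel_def)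
          interpret prob_space "law l (\<theta>, x)"
            by (rule prob_space_law[OF z])
          have "emeasure (law l (\<theta>, x)) {\<omega>\<in>space paths. E l \<omega>} = ennreal (\<P>(\<omega> in law l (\<theta>, x). E l \<omega>))"
            by (simp add: emeasure_eq_measure space_law[OF z])
          also have "\<dots> \<le> ?s l"
            using \<theta> x by (intro SUP_upper2[of "(\<theta>, x)"]) auto
          also have "\<dots> < q"
            by (rule l1[OF \<open>l \<ge> l1\<close>])
          finally show "emeasure (law l (\<theta>, x)) {\<omega>\<in>space paths. E l \<omega>} \<le> q"
            by simp
        qed
      qed
      have "limsup (\<lambda>i. ereal (\<gamma> i)) < ereal \<delta>"
        using \<gamma>_limsup \<delta> by simp
      from Limsup_lessD[OF this] obtain l2 where l2: "\<And>i. i \<ge> l2 \<Longrightarrow> \<gamma> i < \<delta>"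
        by (auto simp: eventually_sequentially)
      \<comment> \<open>From \<open>l0\<close> on, both the noise bound and the step size bound by
        \<delta> hold.\<close>
      define l0 where "l0 = max l1 l2"
      \<comment> \<open>\<open>C\<close> need not be measurable; \<open>D\<close> is a measurable set that contains \<open>W\<^bsub>M0\<^esub> \<times> C\<close> and on
        which the noise bound still holds.\<close>
      define D where "D = {z \<in> space ?S. fst z \<in> ?V \<and>
        (\<forall>l\<in>{l0..}. emeasure (law l z) {\<omega>\<in>space paths. E l \<omega>} \<le> q)}"
      define G where "G = {z \<in> space ?S. fst z \<notin> ?W}"
      have D: "D \<in> sets ?S"
      proof -
        have [measurable]: "(\<lambda>z. emeasure (law l z) {\<omega>\<in>space paths. E l \<omega>}) \<in> borel_measurable ?S" for l
          using E_pred[of l] by (intro measurable_compose[OF measurable_prob_algebraD[OF measurable_law]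
              measurable_emeasure_subprob_algebra]) (simp add: pred_def)
        note [measurable] = pred_fst
        show ?thesis
          unfolding D_def by measurable
      qed
      have G: "G \<in> sets ?S"
        using pred_intros_logic(2)[OF pred_fst[of M]] unfolding G_def pred_def .
      have C_D: "?V \<times> C \<subseteq> D"
        using q C by (auto simp: D_def l0_def space_sa_space sublevel_def)
      \<comment> \<open>The start and the recursion hold almost surely under \<open>law l z\<close>.
        Off a null set the deterministic stability result therefore shows that an exit forces
        \<open>E l\<close>, whose probability is at most \<open>q\<close> on
        \<open>D\<close>.\<close>
      have exit_D: "emeasure (law l z) {\<omega>\<in>space paths. \<exists>i. \<omega> i \<in> G} \<le> q" if "l \<ge> l0" "z \<in> D" for l z
      proof -
        have z: "z \<in> space ?S" and z0: "fst z \<in> ?V"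
          and zq: "emeasure (law l z) {\<omega>\<in>space paths. E l \<omega>} \<le> q"
          using that by (auto simp: D_def)
        have "AE \<omega> in law l z. fst (\<omega> 0) \<in> ?V"
          by (rule AE_law_start[OF pred_fst z z0])
        moreover have "AE \<omega> in law l z. \<forall>n. fst (\<omega> (Suc n)) =
            fst (\<omega> n) + \<gamma> (Suc (n + l)) *\<^sub>R H (fst (\<omega> n)) (snd (\<omega> (Suc n)))"
        proof (rule AE_law_transition[OF _ _ z])
          show "AE z' in ?K i z. fst z' = fst z + \<gamma> (Suc i) *\<^sub>R H (fst z) (snd z')" if "z \<in> space ?S" for i z
            by (rule AE_sa_kernel[OF P_kernel H_measurable stay that])
          show "Measurable.pred (?S \<Otimes>\<^sub>M ?S)
              (\<lambda>(z, z'). fst z' = fst z + \<gamma> (Suc i) *\<^sub>R H (fst z) (snd z'))" for i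
          proof -
            have "(\<lambda>p. fst (snd p) - (fst (fst p) + \<gamma> (Suc i) *\<^sub>R H (fst (fst p)) (snd (snd p))))
                \<in> borel_measurable (?S \<Otimes>\<^sub>M ?S)"
              by (intro borel_measurable_diff borel_measurable_add borel_measurable_scaleR borel_measurable_const
                  borel_measurable_sa_field[OF H_measurable] measurable_fst measurable_snd
                  measurable_compose[OF measurable_fst borel_measurable_sa_space_fst]
                  measurable_compose[OF measurable_snd borel_measurable_sa_space_fst])
            from measurable_sets[OF this, of "{0}"] show ?thesis
              by (simp add: pred_def vimage_def Int_def conj_commute split_beta')
          qed
        qed
        ultimately have "AE \<omega> in law l z. (\<exists>i. \<omega> i \<in> G) \<longrightarrow> E l \<omega>"
        proof eventually_elim
          case (elim \<omega>)
          have "\<not> (\<exists>i. \<omega> i \<in> G)" if notE: "\<not> E l \<omega>"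
          proof -
            have bound: "of_bool (enat k \<le> exit_time ?W \<omega>) * norm (\<Sum>j = 1..k. \<gamma> (j + l) *\<^sub>R noise H h \<omega> j) \<le> \<epsilon>"
              if "k \<ge> 1" for k
              using notE that unfolding E_def not_less SUP_le_iff by simp
            \<comment> \<open>The step from time \<open>i\<close> to \<open>i + 1\<close> has size
              \<open>\<gamma> (Suc i + l)\<close>, which is the \<open>c i\<close> of
              \<open>stable\<close>.\<close>
            have "fst (\<omega> n) \<in> \<Theta> \<and> w (fst (\<omega> n)) \<le> Mr" for n
            proof (rule stable)
              show "fst (\<omega> 0) \<in> \<Theta>" "w (fst (\<omega> 0)) \<le> M0"
                using elim(1) by (simp_all add: W0_eq)
              show "\<forall>i. 0 \<le> \<gamma> (Suc i + l) \<and> \<gamma> (Suc i + l) \<le> \<delta>"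
                using \<gamma>0 l2 \<open>l \<ge> l0\<close> by (auto simp: l0_def intro!: less_imp_le)
              show "\<forall>k\<ge>1. (\<forall>i<k. fst (\<omega> i) \<in> \<Theta> \<and> w (fst (\<omega> i)) \<le> Mr) \<longrightarrow>
                 norm (fst (\<omega> k) - fst (\<omega> 0) - (\<Sum>i<k. \<gamma> (Suc i + l) *\<^sub>R h (fst (\<omega> i)))) \<le> \<epsilon>"
              proof (intro allI impI)
                fix k :: nat assume "k \<ge> 1" and in_W: "\<forall>i<k. fst (\<omega> i) \<in> \<Theta> \<and> w (fst (\<omega> i)) \<le> Mr"
                \<comment> \<open>No exit before \<open>k\<close> makes the indicator equal to 1, so
                  \<open>bound\<close> controls the noise sum itself.\<close>
                then have "enat k \<le> exit_time ?W \<omega>"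
                  by (simp add: le_exit_time_iff W_eq)
                with bound[OF \<open>k \<ge> 1\<close>] have "norm (\<Sum>j = 1..k. \<gamma> (j + l) *\<^sub>R noise H h \<omega> j) \<le> \<epsilon>"
                  by simp
                then show "norm (fst (\<omega> k) - fst (\<omega> 0) - (\<Sum>i<k. \<gamma> (Suc i + l) *\<^sub>R h (fst (\<omega> i)))) \<le> \<epsilon>"
                  using elim(2) by (subst (asm) sum_noise_eq) simp_all
              qed
            qed
            then show ?thesis
              by (auto simp: G_def W_eq)
          qed
          then show ?case by blast
        qed
        then have "emeasure (law l z) {\<omega>\<in>space paths. \<exists>i. \<omega> i \<in> G} \<le> emeasure (law l z) {\<omega>\<in>space paths. E l \<omega>}"
          using E_pred[of l] by (intro emeasure_mono_AE) (auto simp: sets_law[OF z] pred_def)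
        with zq show ?thesis by simp
      qed
      have io_0: "emeasure (law 0 (\<theta>, x))
          {\<omega>\<in>space paths. (\<forall>k::nat. \<exists>i\<ge>k. \<omega> i \<in> D) \<and> (\<forall>k::nat. \<exists>i\<ge>k. \<omega> i \<in> G)} = 0"
        by (rule emeasure_law_io_both_eq_0[OF D G \<open>q < 1\<close> exit_D z])
      have "AE \<omega> in law 0 (\<theta>, x). \<not> ((\<forall>k::nat. \<exists>i\<ge>k. \<omega> i \<in> D) \<and> (\<forall>k::nat. \<exists>i\<ge>k. \<omega> i \<in> G))"
        by (rule AE_law_iff[THEN iffD2, OF _ z])
           (use io_0 in \<open>simp_all only: not_not pred_intros_logic(2,3) pred_ex_mem(3)[OF D] pred_ex_mem(3)[OF G]\<close>)
      moreover have "AE \<omega> in law 0 (\<theta>, x). \<forall>k\<ge>1. \<exists>i\<ge>k. \<omega> i \<in> ?V \<times> C"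
      proof -
        define A where "A = {\<omega> \<in> space (law 0 (\<theta>, x)). \<forall>k\<ge>1. \<exists>i\<ge>k. \<omega> i \<in> ?V \<times> C}"
        have A1: "L.prob A = 1"
          using recurrent[rule_format, OF \<theta> x] unfolding law_0 A_def .
        \<comment> \<open>A set that is not measurable has measure 0, so \<open>A\<close> is measurable although \<open>C\<close> need not be.\<close>
        have "A \<in> L.events"
          by (rule ccontr) (use A1 measure_notin_sets[of A] in simp)
        from L.prob_Collect_eq_1[OF this[unfolded A_def], THEN iffD1, OF A1[unfolded A_def]] show ?thesis .
      qed
      \<comment> \<open>\<open>G\<close> contains only points of the state space, so avoiding
        \<open>G\<close> means being in \<open>?W\<close> only for coordinates known to lie
        there.\<close>
      moreover have "AE \<omega> in law 0 (\<theta>, x). \<forall>i. \<omega> i \<in> space ?S"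
        by (rule AE_I2) (simp add: space_law[OF z] space_PiM PiE_iff)
      ultimately have "AE \<omega> in law 0 (\<theta>, x). \<exists>k\<ge>1. \<forall>i\<ge>k. fst (\<omega> i) \<in> ?W"
      proof eventually_elim
        case (elim \<omega>)
        have "\<exists>i\<ge>k. \<omega> i \<in> D" for k :: nat
        proof -
          have "\<exists>i\<ge>Suc k. \<omega> i \<in> ?V \<times> C"
            using elim(2)[rule_format, of "Suc k"] by simp
          then obtain i where "i \<ge> Suc k" "\<omega> i \<in> ?V \<times> C"
            by (elim exE conjE)
          then have "i \<ge> k \<and> \<omega> i \<in> D"
            using subsetD[OF C_D] by simp
          then show ?thesis ..
        qed
        with elim(1) obtain k :: nat where "\<And>i. i \<ge> k \<Longrightarrow> \<omega> i \<notin> G"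
          by metis
        \<comment> \<open>\<open>Suc k\<close> is the witness because the index has to be at least
          1.\<close>
        with elim(3) show ?case
          by (intro exI[of _ "Suc k"]) (auto simp: G_def)
      qed
      moreover have "Measurable.pred paths (\<lambda>\<omega>. \<exists>k\<ge>1. \<forall>i\<ge>k. fst (\<omega> i) \<in> ?W)"
      proof -
        have [measurable]: "Measurable.pred paths (\<lambda>\<omega>. fst (\<omega> i) \<in> ?W)" for i
          by (rule measurable_compose[of "\<lambda>\<omega>. \<omega> i" paths ?S, OF measurable_component_singleton pred_fst[of M]]) simp
        show ?thesis
          by measurable
      qed
      then have "{\<omega> \<in> space (law 0 (\<theta>, x)). \<exists>k\<ge>1. \<forall>i\<ge>k. fst (\<omega> i) \<in> ?W} \<in> L.events"
        unfolding pred_def space_law[OF z] sets_law[OF z] .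
      ultimately show ?thesis
        unfolding law_0 by (intro L.prob_Collect_eq_1[THEN iffD2])
    qed
  qed
qed

end
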